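(* Let $1\le q<p$ be fixed integers and let $\alpha\in(0,1)$. Suppose the data follow the linear model $y_i=\mathbf{x}_i^T\beta+\epsilon_i$, $i=1,\ldots,n$, with fixed unknown $\beta\in\mathbb{R}^p$, where $\epsilon_i$ are IID $N(0,\sigma^2)$ with $\sigma^2>0$, the $\mathbf{x}_i\in\mathbb{R}^p$ are IID from a normal distribution, and the $\epsilon_i$ are independent of the $\mathbf{x}_i$. Write $\mathbf{x}_i=(\mathbf{z}_i^T,\mathbf{w}_i^T)^T$ with $\mathbf{z}_i\in\mathbb{R}^q$, let $\beta_2$ be the last $p-q$ elements of $\beta$, and let $\Sigma_{\mathrm{w|z}}=\mathrm{var}(\mathbf{w}_1\mid\mathbf{z}_1)$. Assume $\beta_2^T\Sigma_{\mathrm{w|z}}\beta_2>0$, and let $\mathbf{x}_{new}=\bar{\mathbf{x}}=\frac1n\sum_{i=1}^n\mathbf{x}_i$. Then $$\lim_{n\to\infty}\mathbb{P}\Big[q_{1-\frac{\alpha}{2}}\big(\{(1-g_{i,new})v_i\}_{i=1}^n\big)-q_{\frac{\alpha}{2}}\big(\{(1-g_{i,new})v_i\}_{i=1}^n\big)>q_{1-\frac{\alpha}{2}}\big(\{(1-h_{i,new})u_i\}_{i=1}^n\big)-q_{\frac{\alpha}{2}}\big(\{(1-h_{i,new})u_i\}_{i=1}^n\big)\Big]=1 .$$ That is, with probability tending to 1, the width of the predictive interval based on the wrong model (using only the covariates $\mathbf{z}_i$), $$\left[\mathbf{z}_{new}^T\hat\gamma+q_{\frac{\alpha}{2}}(\{(1-g_{i,new})v_i\}_{i=1}^n),\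 \mathbf{z}_{new}^T\hat\gamma+q_{1-\frac{\alpha}{2}}(\{(1-g_{i,new})v_i\}_{i=1}^n)\right],$$ is larger than the width of the predictive interval based on the true model, $$\left[\mathbf{x}_{new}^T\hat\beta+q_{\frac{\alpha}{2}}(\{(1-h_{i,new})u_i\}_{i=1}^n),\ \mathbf{x}_{new}^T\hat\beta+q_{1-\frac{\alpha}{2}}(\{(1-h_{i,new})u_i\}_{i=1}^n)\right].$$
   Context: $q_\alpha(\{a_i\}_{i=1}^n)$ denotes the $\alpha$-th (empirical) quantile of $a_1,\ldots,a_n$. $\mathbf{Y}=(y_1,\ldots,y_n)^T$; $\mathbf{X}$ is the $n\times p$ design matrix with rows $\mathbf{x}_i^T$, partitioned as $\mathbf{X}=(\mathbf{Z},\mathbf{W})$, where $\mathbf{Z}$ is $n\times q$ with rows $\mathbf{z}_i^T$ and $\mathbf{W}$ is $n\times(p-q)$ with rows $\mathbf{w}_i^T$; likewise $\mathbf{x}_{new}=(\mathbf{z}_{new}^T,\mathbf{w}_{new}^T)^T$. The matrices $\mathbf{X}^T\mathbf{X}$ and $\mathbf{Z}^T\mathbf{Z}$ are taken to be invertible so that the least squares estimators below are defined. True model (least squares on all $p$ covariates): $\hat\beta=(\mathbf{X}^T\mathbf{X})^{-1}\mathbf{X}^T\mathbf{Y}$, $h_{ii}=\mathbf{x}_i^T(\mathbf{X}^T\mathbf{X})^{-1}\mathbf{x}_i$, $h_{i,new}=\mathbf{x}_{new}^T(\mathbf{X}^T\mathbf{X})^{-1}\mathbf{x}_i$, $u_i=\dfrac{y_i-\mathbf{x}_i^T\hat\beta}{1-h_{ii}}$.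 Wrong model (least squares on the first $q$ covariates only): $\hat\gamma=(\mathbf{Z}^T\mathbf{Z})^{-1}\mathbf{Z}^T\mathbf{Y}$, $g_{ii}=\mathbf{z}_i^T(\mathbf{Z}^T\mathbf{Z})^{-1}\mathbf{z}_i$, $g_{i,new}=\mathbf{z}_{new}^T(\mathbf{Z}^T\mathbf{Z})^{-1}\mathbf{z}_i$, $v_i=\dfrac{y_i-\mathbf{z}_i^T\hat\gamma}{1-g_{ii}}$. *)

theory Defs
  imports "HOL-Analysis.Analysis" "HOL-Probability.Probability"
begin

text \<open>
  Covariate vectors in \<open>\<real>\<^sup>p\<close> are indexed by a sum type \<open>'q + 'r\<close> of finite types, with
  \<open>q = CARD('q) \<ge> 1\<close> and \<open>p - q = CARD('r) \<ge> 1\<close>.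
\<close>

definition first_part :: "real ^ ('q::finite + 'r::finite) \<Rightarrow> real ^ 'q"
  where "first_part x = (\<chi> j. x $ Inl j)"

definition last_part :: "real ^ ('q::finite + 'r::finite) \<Rightarrow> real ^ 'r"
  where "last_part x = (\<chi> j. x $ Inr j)"

text \<open>
  The sample size \<open>n\<close> varies, so the \<open>n \<times> d\<close> design matrix \<open>X\<close> is given by its sequence of
  rows \<open>x i\<close>, \<open>i < n\<close> (counted from 0). The products \<open>X\<^sup>T X\<close> and \<open>X\<^sup>T Y\<close> are written out
  entrywise.
\<close>

definition gram :: "nat \<Rightarrow> (nat \<Rightarrow> real ^ 'd) \<Rightarrow> real ^ 'd ^ 'd::finite"
  where "gram n x = (\<chi> j k. \<Sum>i<n. x i $ j * x i $ k)"

definition cross :: "nat \<Rightarrow> (nat \<Rightarrow> real ^ 'd) \<Rightarrow> (nat \<Rightarrow> real) \<Rightarrow> real ^ 'd::finite"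
  where "cross n x y = (\<chi> j. \<Sum>i<n. x i $ j * y i)"

definition ls_estimator :: "nat \<Rightarrow> (nat \<Rightarrow> real ^ 'd) \<Rightarrow> (nat \<Rightarrow> real) \<Rightarrow> real ^ 'd::finite"
  where "ls_estimator n x y = matrix_inv (gram n x) *v cross n x y"

definition leverage :: "nat \<Rightarrow> (nat \<Rightarrow> real ^ 'd) \<Rightarrow> real ^ 'd \<Rightarrow> real ^ 'd::finite \<Rightarrow> real"
  where "leverage n x a b = a \<bullet> (matrix_inv (gram n x) *v b)"

definition loo_residual :: "nat \<Rightarrow> (nat \<Rightarrow> real ^ 'd::finite) \<Rightarrow> (nat \<Rightarrow> real) \<Rightarrow> nat \<Rightarrow> real"
  where "loo_residual n x y i =
    (y i - x i \<bullet> ls_estimator n x y) / (1 - leverage n x (x i) (x i))"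

text \<open>The left-continuous generalised inverse of the empirical distribution function.\<close>

definition emp_quantile :: "real \<Rightarrow> nat \<Rightarrow> (nat \<Rightarrow> real) \<Rightarrow> real"
  where "emp_quantile \<tau> n a = Inf {t. real (card {i. i < n \<and> a i \<le> t}) / real n \<ge> \<tau>}"

text \<open>
  Multivariate normal laws: all one-dimensional projections are normal. A degenerate covariance
  matrix is allowed, in which case some projections are point masses.
\<close>

definition normal_law :: "real measure \<Rightarrow> bool"
  where "normal_law N \<longleftrightarrow>
    (\<exists>m. N = return borel m) \<or> (\<exists>m s. 0 < s \<and> N = density lborel (\<lambda>t. ennreal (normal_density m s t)))"

definition mv_normal_law :: "(real ^ 'd::finite) measure \<Rightarrow> bool"
  where "mv_normal_law N \<longleftrightarrow> sets N = sets borel \<and> (\<forall>a. normal_law (distr N borel (\<lambda>v. a \<bullet> v)))"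

definition cond_var ::
  "'a measure \<Rightarrow> ('a \<Rightarrow> real ^ 'r::finite) \<Rightarrow> ('a \<Rightarrow> real ^ 'q::finite) \<Rightarrow> 'a \<Rightarrow> real ^ 'r ^ 'r"
  where "cond_var M w z =
    (let F = vimage_algebra (space M) z borel;
         r = (\<lambda>j \<omega>. w \<omega> $ j - real_cond_exp M F (\<lambda>\<omega>. w \<omega> $ j) \<omega>)
     in (\<lambda>\<omega>. \<chi> j k. real_cond_exp M F (\<lambda>\<omega>. r j \<omega> * r k \<omega>) \<omega>))"

end

theory Submission
  imports Defs
begin

text \<open>
  Both widths converge in probability, and the limits can be compared. In either regression the
  response is a linear function of the covariates used plus an error that is orthogonal to
  them, in the sense that the products have mean 0: \<open>eps\<close> for the full model, and \<open>e i = y i - z i \<bullet> \<gamma>\<close> for the reduced one, where \<open>\<gamma>\<close> is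
  the population least squares coefficient. The reduced model has no intercept, so \<open>e i\<close> may have
  a nonzero mean and may depend on \<open>z i\<close>, but it is normal, being \<open>eps i\<close> plus an
  independent linear function of \<open>x i\<close>. This linear function has the same
  coefficients \<open>\<beta>\<^sub>2\<close> on the omitted covariates as the true model. If it were almost surely
  constant, \<open>\<beta>\<^sub>2 \<bullet> w i\<close> would be an affine function of \<open>z i\<close> and the conditional variance
  \<open>\<beta>\<^sub>2\<^sup>T \<Sigma> \<beta>\<^sub>2\<close> would vanish (\<open>cond_var_affine\<close>). Hence the standard deviation \<open>s\<close> of
  \<open>e i\<close> strictly exceeds \<open>\<sigma>\<close> (\<open>omitted_covariates_error_normal\<close>).

  The leverage of an observation with bounded covariates is of order \<open>1/n\<close>, and so is its
  leverage at the new point, since the sample mean stays bounded; moreover the coefficient estimate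
  is consistent. So all but an arbitrarily small fraction of the corrected residuals are close to the
  true errors
  (\<open>far_fraction_loo_residuals\<close>), which is enough for the empirical quantiles to converge to those
  of the error distribution (\<open>tendsto_emp_quantile\<close>). With \<open>q\<close> denoting standard normal
  quantiles, the widths tend to \<open>s * (q (1 - \<alpha>/2) - q (\<alpha>/2))\<close> and
  \<open>\<sigma> * (q (1 - \<alpha>/2) - q (\<alpha>/2))\<close>, and the first limit is larger.

  Convergence in probability is expressed as convergence along a filter on pairs of a sample size
  and a sample point (\<open>high_prob\<close>). The analytic part of the argument is thereby an ordinary
  limit computation along a filter; probability enters through the weak law of large numbers
  (\<open>weak_law\<close>) for products of two normal variables and for indicators.
\<close>

section \<open>Empirical distribution functions and quantiles\<close>

definition edf :: "nat \<Rightarrow> (nat \<Rightarrow> real) \<Rightarrow> real \<Rightarrow> real"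
  where "edf n a t = real (card {i. i < n \<and> a i \<le> t}) / real n"

definition far_fraction :: "nat \<Rightarrow> (nat \<Rightarrow> real) \<Rightarrow> (nat \<Rightarrow> real) \<Rightarrow> real \<Rightarrow> real"
  where "far_fraction n a e \<delta> = real (card {i. i < n \<and> \<delta> < \<bar>a i - e i\<bar>}) / real n"

lemma edf_mono: "s \<le> t \<Longrightarrow> edf n a s \<le> edf n a t"
  unfolding edf_def by (intro divide_right_mono of_nat_mono card_mono) auto

text \<open>
  Galois connection between quantile and distribution function: the infimum is attained because
  the empirical distribution function is right-continuous. Every later argument about quantiles,
  including measurability, goes through this equivalence.
\<close>

lemma emp_quantile_le_iff:
  assumes n: "0 < n" and \<tau>: "0 < \<tau>" "\<tau> \<le> 1"
  shows "emp_quantile \<tau> n a \<le> c \<longleftrightarrow> \<tau> \<le> edf n a c"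
proof -
  define S where "S = {t. \<tau> \<le> edf n a t}"
  have q: "emp_quantile \<tau> n a = Inf S"
    unfolding emp_quantile_def S_def edf_def by simp
  have fin: "finite (a ` {..<n})" and ne: "a ` {..<n} \<noteq> {}" using n by auto
  have "{i. i < n \<and> a i \<le> Max (a ` {..<n})} = {..<n}" by (auto intro!: Max_ge)
  then have "Max (a ` {..<n}) \<in> S" using n \<tau> by (simp add: S_def edf_def)
  then have Sne: "S \<noteq> {}" by blast
  have low: "Min (a ` {..<n}) \<le> t" if "t \<in> S" for t
  proof (rule ccontr)
    assume "\<not> Min (a ` {..<n}) \<le> t"
    then have "t < a i" if "i < n" for i
      using Min_le[OF fin, of "a i"] that by (smt (verit) imageI lessThan_iff)
    then have none: "{i. i < n \<and> a i \<le> t} = {}" by (auto simp: not_le)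
    have "edf n a t = 0" unfolding edf_def none by simp
    then show False using that \<tau> by (simp add: S_def)
  qed
  then have bdd: "bdd_below S" by (rule bdd_belowI)
  have up: "t \<in> S" if "s \<in> S" "s \<le> t" for s t
    using that edf_mono[of s t n a] by (auto simp: S_def)
  have attained: "Inf S \<in> S"
  proof (rule ccontr)
    assume notin: "Inf S \<notin> S"
    define B where "B = {a i |i. i < n \<and> Inf S < a i}"
    have "finite B" by (auto simp: B_def)
    \<comment> \<open>No sample value lies in the half-open interval from \<open>Inf S\<close> (excluded) to \<open>t\<close>.\<close>
    define t where "t = (if B = {} then Inf S + 1 else (Inf S + Min B) / 2)"
    have t: "Inf S < t" "\<And>b. b \<in> B \<Longrightarrow> t < b"
    proof -
      have *: "Inf S < Min B" if "B \<noteq> {}"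
        using \<open>finite B\<close> that by (subst Min_gr_iff) (auto simp: B_def)
      show "Inf S < t" using * by (auto simp: t_def)
      fix b assume "b \<in> B"
      then have "Inf S < Min B" "Min B \<le> b" using \<open>finite B\<close> by (auto intro!: *)
      then show "t < b" using \<open>b \<in> B\<close> by (auto simp: t_def)
    qed
    have "{i. i < n \<and> a i \<le> t} = {i. i < n \<and> a i \<le> Inf S}"
      using t by (fastforce simp: B_def)
    then have "t \<notin> S" using notin by (simp add: S_def edf_def)
    then have "t \<le> Inf S" using up Sne by (intro cInf_greatest) (auto intro: less_imp_le simp: not_le[symmetric])
    then show False using t by simp
  qed
  show ?thesis
  proof
    assume "emp_quantile \<tau> n a \<le> c"
    then show "\<tau> \<le> edf n a c" using up[OF attained] by (simp add: q S_def)
  next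
    assume "\<tau> \<le> edf n a c"
    then show "emp_quantile \<tau> n a \<le> c" unfolding q by (intro cInf_lower bdd) (simp add: S_def)
  qed
qed

text \<open>
  A sample point whose value moves by at most \<open>\<delta>\<close> cannot leave the half-line by more than
  \<open>\<delta>\<close>; all others are counted in \<open>far_fraction\<close>.
\<close>

lemma edf_le_perturbed:
  assumes "s + \<delta> \<le> t"
  shows "edf n e s \<le> edf n a t + far_fraction n a e \<delta>"
proof -
  have "card {i. i < n \<and> e i \<le> s} \<le> card ({i. i < n \<and> a i \<le> t} \<union> {i. i < n \<and> \<delta> < \<bar>a i - e i\<bar>})"
    using assms by (intro card_mono) auto
  also have "\<dots> \<le> card {i. i < n \<and> a i \<le> t} + card {i. i < n \<and> \<delta> < \<bar>a i - e i\<bar>}"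
    by (rule card_Un_le)
  finally show ?thesis
    unfolding edf_def far_fraction_def add_divide_distrib[symmetric]
    by (intro divide_right_mono) linarith+
qed

lemma far_fraction_commute: "far_fraction n a e \<delta> = far_fraction n e a \<delta>"
  by (simp add: far_fraction_def abs_minus_commute)

text \<open>
  Quantiles are continuous functionals of the distribution function wherever the limit \<open>G\<close> crosses
  the level \<open>\<tau>\<close> strictly, and they ignore a vanishing fraction of the sample. Here \<open>e\<close> are the
  ideal observations and \<open>a\<close> the perturbed ones.
\<close>

lemma tendsto_emp_quantile:
  fixes a e :: "'c \<Rightarrow> nat \<Rightarrow> real"
  assumes n: "\<forall>\<^sub>F c in F. 0 < n c" and \<tau>: "0 < \<tau>" "\<tau> \<le> 1"
    and edf: "\<And>t. ((\<lambda>c. edf (n c) (e c) t) \<longlongrightarrow> G t) F"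
    and far: "\<And>\<delta>. 0 < \<delta> \<Longrightarrow> ((\<lambda>c. far_fraction (n c) (a c) (e c) \<delta>) \<longlongrightarrow> 0) F"
    and G: "\<And>\<epsilon>. 0 < \<epsilon> \<Longrightarrow> G (q - \<epsilon>) < \<tau>" "\<And>\<epsilon>. 0 < \<epsilon> \<Longrightarrow> \<tau> < G (q + \<epsilon>)"
  shows "((\<lambda>c. emp_quantile \<tau> (n c) (a c)) \<longlongrightarrow> q) F"
proof (rule tendstoI)
  fix \<epsilon> :: real assume "0 < \<epsilon>"
  define \<delta> where "\<delta> = \<epsilon> / 4"
  have \<delta>: "0 < \<delta>" using \<open>0 < \<epsilon>\<close> by (simp add: \<delta>_def)
  have "((\<lambda>c. edf (n c) (e c) (q + \<delta>) - far_fraction (n c) (a c) (e c) \<delta>) \<longlongrightarrow> G (q + \<delta>) - 0) F"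
    by (intro tendsto_diff edf far \<delta>)
  then have 1: "\<forall>\<^sub>F c in F. \<tau> < edf (n c) (e c) (q + \<delta>) - far_fraction (n c) (a c) (e c) \<delta>"
    using G(2)[OF \<delta>] by (intro order_tendstoD(1)) auto
  have "((\<lambda>c. edf (n c) (e c) (q - \<delta>) + far_fraction (n c) (a c) (e c) \<delta>) \<longlongrightarrow> G (q - \<delta>) + 0) F"
    by (intro tendsto_add edf far \<delta>)
  then have 2: "\<forall>\<^sub>F c in F. edf (n c) (e c) (q - \<delta>) + far_fraction (n c) (a c) (e c) \<delta> < \<tau>"
    using G(1)[OF \<delta>] by (intro order_tendstoD(2)) auto
  show "\<forall>\<^sub>F c in F. dist (emp_quantile \<tau> (n c) (a c)) q < \<epsilon>"
    using n 1 2
  proof eventually_elim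
    case (elim c)
    have "\<tau> \<le> edf (n c) (a c) (q + 2 * \<delta>)"
      using edf_le_perturbed[of "q + \<delta>" \<delta> "q + 2 * \<delta>" "n c" "e c" "a c"] elim by simp
    moreover have "edf (n c) (a c) (q - 2 * \<delta>) < \<tau>"
      using edf_le_perturbed[of "q - 2 * \<delta>" \<delta> "q - \<delta>" "n c" "a c" "e c"] elim
      by (simp add: far_fraction_commute[of _ "e c"])
    ultimately have "emp_quantile \<tau> (n c) (a c) \<le> q + 2 * \<delta>" "q - 2 * \<delta> < emp_quantile \<tau> (n c) (a c)"
      using elim \<tau> emp_quantile_le_iff[of "n c" \<tau> "a c"] by (auto simp: not_le simp flip: not_less)
    then show ?case using \<open>0 < \<epsilon>\<close> by (simp add: dist_real_def \<delta>_def abs_less_iff)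
  qed
qed

section \<open>Least squares residuals with corrected leverage\<close>

lemma norm_matrix_vector_mult_le:
  fixes A :: "real ^ 'n::finite ^ 'm::finite"
  shows "norm (A *v x) \<le> norm A * norm x"
proof -
  have "norm (A *v x) = L2_set (\<lambda>i. \<bar>A $ i \<bullet> x\<bar>) UNIV"
    by (simp add: norm_vec_def matrix_mult_dot)
  also have "\<dots> \<le> L2_set (\<lambda>i. norm (A $ i) * norm x) UNIV"
    by (intro L2_set_mono) (auto simp: Cauchy_Schwarz_ineq2)
  also have "\<dots> = norm A * norm x"
    by (simp add: norm_vec_def[of A] L2_set_left_distrib[symmetric])
  finally show ?thesis .
qed

lemma matrix_inv_cancel:
  assumes "invertible A"
  shows "A *v (matrix_inv A *v v) = v" "matrix_inv A *v (A *v v) = v"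
proof -
  have "A ** matrix_inv A = mat 1 \<and> matrix_inv A ** A = mat 1"
    using assms unfolding invertible_def matrix_inv_def by (rule someI_ex)
  then show "A *v (matrix_inv A *v v) = v" "matrix_inv A *v (A *v v) = v"
    by (simp_all add: matrix_vector_mul_assoc)
qed

text \<open>
  The bound on the inverse is stated through the lower bound on \<open>A\<close>, which is stable under
  perturbation by the triangle inequality; this gives invertibility of \<open>A\<close> at the same time and
  avoids continuity of the matrix inverse.
\<close>

lemma invertible_near:
  fixes S :: "real ^ 'd::finite ^ 'd"
  assumes "invertible S"
  obtains K \<eta> where "0 < K" "0 < \<eta>"
    "\<And>A. norm (A - S) < \<eta> \<Longrightarrow> invertible A" "\<And>A v. norm (A - S) < \<eta> \<Longrightarrow> norm v \<le> K * norm (A *v v)"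
proof -
  define L where "L = norm (matrix_inv S) + 1"
  have L: "0 < L" by (simp add: L_def add_nonneg_pos)
  have S: "norm v \<le> L * norm (S *v v)" for v
  proof -
    have "norm v \<le> norm (matrix_inv S) * norm (S *v v)"
      using norm_matrix_vector_mult_le[of "matrix_inv S" "S *v v"] by (simp add: matrix_inv_cancel[OF assms])
    also have "\<dots> \<le> L * norm (S *v v)" by (intro mult_right_mono) (auto simp: L_def)
    finally show ?thesis .
  qed
  have bound: "norm v \<le> (2 * L) * norm (A *v v)" if A: "norm (A - S) < 1 / (2 * L)" for A v
  proof -
    have "S *v v = A *v v - (A - S) *v v" by (simp add: matrix_vector_mult_diff_rdistrib)
    then have "norm (S *v v) \<le> norm (A *v v) + norm ((A - S) *v v)"
      by (metis norm_triangle_ineq4)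
    also have "norm ((A - S) *v v) \<le> norm (A - S) * norm v" by (rule norm_matrix_vector_mult_le)
    also have "\<dots> \<le> 1 / (2 * L) * norm v" using A by (intro mult_right_mono) auto
    finally have "L * norm (S *v v) \<le> L * (norm (A *v v) + 1 / (2 * L) * norm v)"
      using L by (simp add: mult_left_mono)
    also have "\<dots> = L * norm (A *v v) + norm v / 2" using L by (simp add: field_simps)
    finally show ?thesis using S[of v] by simp
  qed
  have inv: "invertible A" if A: "norm (A - S) < 1 / (2 * L)" for A
  proof -
    have "A *v v = 0 \<Longrightarrow> v = 0" for v using bound[OF A, of v] by simp
    then show ?thesis
      by (simp add: invertible_left_inverse matrix_left_invertible_ker)
  qed
  show ?thesis by (rule that[of "2 * L" "1 / (2 * L)"]) (use L bound inv in auto)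
qed

lemma gram_mult: "gram n x *v b = (\<Sum>i<n. (x i \<bullet> b) *\<^sub>R x i)"
  unfolding gram_def matrix_vector_mult_def vec_eq_iff inner_vec_def
  by (simp add: sum_distrib_left sum_distrib_right sum.swap[of _ "{..<n}" UNIV] mult_ac)

lemma cross_eq: "cross n x y = (\<Sum>i<n. y i *\<^sub>R x i)"
  unfolding cross_def vec_eq_iff by (simp add: mult.commute)

lemma ls_estimator_error:
  assumes "invertible (gram n x)" "\<And>i. i < n \<Longrightarrow> y i = x i \<bullet> b + e i"
  shows "ls_estimator n x y = b + matrix_inv (gram n x) *v cross n x e"
proof -
  have "cross n x y = gram n x *v b + cross n x e"
    by (simp add: cross_eq gram_mult assms(2) scaleR_left_distrib sum.distrib)
  then show ?thesis
    by (simp add: ls_estimator_def matrix_vector_right_distrib matrix_inv_cancel[OF assms(1)])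
qed

lemma norm_matrix_inv_gram_le:
  assumes n: "0 < n" and inv: "invertible (gram n x)"
    and K: "\<And>v. norm v \<le> K * norm (((1 / real n) *\<^sub>R gram n x) *v v)"
  shows "norm (matrix_inv (gram n x) *v v) \<le> K / n * norm v"
proof -
  have "gram n x *v (matrix_inv (gram n x) *v v) = v"
    by (rule matrix_inv_cancel[OF inv])
  then have "((1 / real n) *\<^sub>R gram n x) *v (matrix_inv (gram n x) *v v) = (1 / real n) *\<^sub>R v"
    by (simp add: scaleR_matrix_vector_assoc[symmetric])
  with K[of "matrix_inv (gram n x) *v v"] show ?thesis by simp
qed

text \<open>
  The corrected residual of observation \<open>i\<close> differs from its error \<open>e i\<close> through three small
  quantities: its own leverage, its leverage at the new point (both of order \<open>1/n\<close> when the
  covariates are bounded by \<open>R\<close>), and the coefficient error \<open>d\<close>, which is of order \<open>\<eta>\<close>.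
\<close>

lemma loo_residual_perturbation:
  assumes n: "0 < n" and inv: "invertible (gram n x)" and y: "\<And>i. i < n \<Longrightarrow> y i = x i \<bullet> b + e i"
    and K: "0 \<le> K" "\<And>v. norm (matrix_inv (gram n x) *v v) \<le> K / n * norm v"
    and T: "norm xnew \<le> T" and \<eta>: "norm (cross n x e) / n \<le> \<eta>"
    and i: "i < n" "norm (x i) \<le> R" "\<bar>e i\<bar> \<le> R" and small: "K * R\<^sup>2 / n \<le> 1 / 2"
  shows "\<bar>(1 - leverage n x xnew (x i)) * loo_residual n x y i - e i\<bar>
    \<le> 2 * (K * R ^ 3 / n + K * T * R\<^sup>2 / n + (1 + K * T * R / n) * (R * (K * \<eta>)))"
proof -
  define d where "d = matrix_inv (gram n x) *v cross n x e"
  define h g where "h = leverage n x (x i) (x i)" and "g = leverage n x xnew (x i)"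
  have R: "0 \<le> R" using i(3) by linarith
  have T0: "0 \<le> T" using T norm_ge_zero[of xnew] by linarith
  have \<eta>0: "0 \<le> \<eta>" using \<eta> norm_ge_zero[of "cross n x e"] n by (smt (verit) divide_nonneg_nonneg of_nat_0_le_iff)
  have lev: "\<bar>leverage n x a (x i)\<bar> \<le> K * norm a * R / n" for a
  proof -
    have "\<bar>leverage n x a (x i)\<bar> \<le> norm a * norm (matrix_inv (gram n x) *v x i)"
      unfolding leverage_def by (rule Cauchy_Schwarz_ineq2)
    also have "\<dots> \<le> norm a * (K / n * R)"
      using K(1) by (intro mult_left_mono order_trans[OF K(2)] i) (auto intro!: mult_left_mono i)
    finally show ?thesis by (simp add: mult_ac)
  qed
  have "\<bar>h\<bar> \<le> K * norm (x i) * R / n" unfolding h_def by (rule lev)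
  also have "\<dots> \<le> K * R * R / n" using K(1) R i by (intro divide_right_mono mult_right_mono mult_left_mono) auto
  finally have h: "\<bar>h\<bar> \<le> K * R\<^sup>2 / n" by (simp add: power2_eq_square mult.assoc)
  have "\<bar>g\<bar> \<le> K * norm xnew * R / n" unfolding g_def by (rule lev)
  also have "\<dots> \<le> K * T * R / n" using K(1) R T by (intro divide_right_mono mult_right_mono mult_left_mono) auto
  finally have g: "\<bar>g\<bar> \<le> K * T * R / n" .
  have "norm d \<le> K * (norm (cross n x e) / n)" using K(2)[of "cross n x e"] by (simp add: d_def)
  also have "\<dots> \<le> K * \<eta>" using K(1) \<eta> by (rule mult_left_mono[rotated])
  finally have "norm (x i) * norm d \<le> R * (K * \<eta>)" using i R by (intro mult_mono) auto
  then have xd: "\<bar>x i \<bullet> d\<bar> \<le> R * (K * \<eta>)" using Cauchy_Schwarz_ineq2[of "x i" d] by linarith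
  have h2: "\<bar>h\<bar> \<le> 1 / 2" using h small by linarith
  have ls: "y i - x i \<bullet> ls_estimator n x y = e i - x i \<bullet> d"
    using i(1) ls_estimator_error[OF inv y] by (simp add: y d_def inner_add_right)
  have eq: "(1 - g) * loo_residual n x y i - e i
      = (h * e i - g * e i - (1 - g) * (x i \<bullet> d)) / (1 - h)"
    using h2 unfolding loo_residual_def ls h_def[symmetric] by (auto simp: field_simps)
  have "\<bar>h * e i - g * e i - (1 - g) * (x i \<bullet> d)\<bar>
      \<le> \<bar>h\<bar> * \<bar>e i\<bar> + \<bar>g\<bar> * \<bar>e i\<bar> + (1 + \<bar>g\<bar>) * \<bar>x i \<bullet> d\<bar>"
  proof -
    have "\<bar>(1 - g) * (x i \<bullet> d)\<bar> \<le> (1 + \<bar>g\<bar>) * \<bar>x i \<bullet> d\<bar>"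
      unfolding abs_mult by (intro mult_right_mono) auto
    then show ?thesis
      using abs_triangle_ineq4[of "h * e i - g * e i" "(1 - g) * (x i \<bullet> d)"]
        abs_triangle_ineq4[of "h * e i" "g * e i"] by (simp add: abs_mult)
  qed
  also have "\<dots> \<le> K * R\<^sup>2 / n * R + K * T * R / n * R + (1 + K * T * R / n) * (R * (K * \<eta>))"
    using h g xd i K(1) R T0 \<eta>0 by (intro add_mono mult_mono) auto
  finally have num: "\<bar>h * e i - g * e i - (1 - g) * (x i \<bullet> d)\<bar>
    \<le> K * R ^ 3 / n + K * T * R\<^sup>2 / n + (1 + K * T * R / n) * (R * (K * \<eta>))"
    by (simp add: power2_eq_square power3_eq_cube mult_ac)
  have "\<bar>(1 - g) * loo_residual n x y i - e i\<bar> \<le> \<bar>h * e i - g * e i - (1 - g) * (x i \<bullet> d)\<bar> / (1 / 2)"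
    unfolding eq abs_divide using h2 by (intro frac_le) auto
  with num show ?thesis unfolding g_def by simp
qed

text \<open>
  Markov's inequality for the empirical second moment.
\<close>

lemma card_large_le:
  fixes f :: "nat \<Rightarrow> real"
  assumes "0 < R"
  shows "real (card {i. i < n \<and> R < \<bar>f i\<bar>}) \<le> (\<Sum>i<n. (f i)\<^sup>2) / R\<^sup>2"
proof -
  have "real (card {i. i < n \<and> R < \<bar>f i\<bar>}) * R\<^sup>2 = (\<Sum>i | i < n \<and> R < \<bar>f i\<bar>. R\<^sup>2)" by simp
  also have "\<dots> \<le> (\<Sum>i | i < n \<and> R < \<bar>f i\<bar>. (f i)\<^sup>2)"
    using assms by (intro sum_mono) (auto simp: abs_le_square_iff[symmetric])
  also have "\<dots> \<le> (\<Sum>i<n. (f i)\<^sup>2)" by (intro sum_mono2) auto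
  finally show ?thesis using assms by (simp add: field_simps)
qed

lemma sum_norm_sq_eq_trace_gram: "(\<Sum>i<n. (norm (x i))\<^sup>2) = (\<Sum>j\<in>UNIV. gram n x $ j $ j)"
  unfolding gram_def power2_norm_eq_inner inner_vec_def by (simp add: sum.swap[of _ "{..<n}" UNIV])

text \<open>
  The observations with covariates and errors bounded by \<open>R\<close> are treated by
  \<open>loo_residual_perturbation\<close>, uniformly. The remaining ones form a fraction of at most
  \<open>C / R\<^sup>2\<close>, because the empirical second moments converge; \<open>R\<close> is chosen before the limit is
  taken. Convergence of the Gram matrix also controls the norm of the sample mean.
\<close>

lemma far_fraction_loo_residuals:
  fixes X :: "'c \<Rightarrow> nat \<Rightarrow> real ^ 'd::finite" and E Y :: "'c \<Rightarrow> nat \<Rightarrow> real" and n :: "'c \<Rightarrow> nat"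
  assumes n: "filterlim n at_top F"
    and gram: "((\<lambda>c. (1 / real (n c)) *\<^sub>R gram (n c) (X c)) \<longlongrightarrow> S) F" and S: "invertible S"
    and cross: "((\<lambda>c. (1 / real (n c)) *\<^sub>R cross (n c) (X c) (E c)) \<longlongrightarrow> 0) F"
    and sq: "((\<lambda>c. (\<Sum>i<n c. (E c i)\<^sup>2) / real (n c)) \<longlongrightarrow> s) F"
    and Y: "\<forall>\<^sub>F c in F. \<forall>i. Y c i = X c i \<bullet> b + E c i"
    and xnew: "\<And>c. xnew c = (1 / real (n c)) *\<^sub>R (\<Sum>i<n c. X c i)"
    and \<delta>: "0 < \<delta>"
  shows "((\<lambda>c. far_fraction (n c)
      (\<lambda>i. (1 - leverage (n c) (X c) (xnew c) (X c i)) * loo_residual (n c) (X c) (Y c) i) (E c) \<delta>) \<longlongrightarrow> 0) F"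
    (is "((\<lambda>c. far_fraction _ (?a c) _ _) \<longlongrightarrow> 0) F")
proof (rule tendstoI)
  fix \<rho> :: real assume "0 < \<rho>"
  obtain K \<eta> where K: "0 < K" "0 < \<eta>" "\<And>A. norm (A - S) < \<eta> \<Longrightarrow> invertible A"
    "\<And>A v. norm (A - S) < \<eta> \<Longrightarrow> norm v \<le> K * norm (A *v v)"
    using invertible_near[OF S] by blast
  define t where "t = (\<Sum>j\<in>UNIV. S $ j $ j)"
  have tr: "((\<lambda>c. (\<Sum>i<n c. (norm (X c i))\<^sup>2) / real (n c)) \<longlongrightarrow> t) F"
  proof -
    have "((\<lambda>c. \<Sum>j\<in>UNIV. ((1 / real (n c)) *\<^sub>R gram (n c) (X c)) $ j $ j) \<longlongrightarrow> t) F"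
      unfolding t_def by (intro tendsto_sum tendsto_vec_nth gram)
    then show ?thesis by (simp add: sum_norm_sq_eq_trace_gram sum_divide_distrib)
  qed
  define T where "T = \<bar>t\<bar> + 2"
  define C where "C = \<bar>t\<bar> + \<bar>s\<bar> + 2"
  have C: "0 < C" by (simp add: C_def)
  define R where "R = sqrt (2 * C / \<rho>)"
  have R: "0 < R" and R2: "C / R\<^sup>2 = \<rho> / 2" using C \<open>0 < \<rho>\<close> by (simp_all add: R_def)
  have n0: "\<forall>\<^sub>F c in F. 0 < n c" 
    using eventually_compose_filterlim[OF eventually_gt_at_top n] .
  have inv0: "((\<lambda>c. 1 / real (n c)) \<longlongrightarrow> 0) F"
    using filterlim_compose[OF lim_1_over_n n] by (simp add: o_def)
  have lim0: "((\<lambda>c. k / real (n c)) \<longlongrightarrow> 0) F" for k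
    using tendsto_mult[OF tendsto_const[of k] inv0] by simp
  have cr: "((\<lambda>c. norm (cross (n c) (X c) (E c)) / real (n c)) \<longlongrightarrow> 0) F"
    using tendsto_norm[OF cross] by (simp add: field_simps)
  have "((\<lambda>c. 2 * (K * R ^ 3 / n c + K * T * R\<^sup>2 / n c
      + (1 + K * T * R / n c) * (R * (K * (norm (cross (n c) (X c) (E c)) / n c)))))
      \<longlongrightarrow> 2 * (0 + 0 + (1 + 0) * (R * (K * 0)))) F"
    by (intro tendsto_intros lim0 cr)
  then have err: "\<forall>\<^sub>F c in F. 2 * (K * R ^ 3 / n c + K * T * R\<^sup>2 / n c
      + (1 + K * T * R / n c) * (R * (K * (norm (cross (n c) (X c) (E c)) / n c)))) < \<delta>"
    using \<delta> by (intro order_tendstoD(2)) auto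
  have near: "\<forall>\<^sub>F c in F. norm ((1 / real (n c)) *\<^sub>R gram (n c) (X c) - S) < \<eta>"
    using tendstoD[OF gram K(2)] by (simp add: dist_norm)
  have small: "\<forall>\<^sub>F c in F. K * R\<^sup>2 / n c < 1 / 2"
    by (intro order_tendstoD(2)[OF lim0]) auto
  have trb: "\<forall>\<^sub>F c in F. (\<Sum>i<n c. (norm (X c i))\<^sup>2) / real (n c) < \<bar>t\<bar> + 1"
    by (intro order_tendstoD(2)[OF tr]) auto
  have sqb: "\<forall>\<^sub>F c in F. (\<Sum>i<n c. (E c i)\<^sup>2) / real (n c) < \<bar>s\<bar> + 1"
    by (intro order_tendstoD(2)[OF sq]) auto
  show "\<forall>\<^sub>F c in F. dist (far_fraction (n c) (?a c) (E c) \<delta>) 0 < \<rho>"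
    using n0 err near small trb sqb Y
  proof eventually_elim
    case (elim c)
    note n = elim(1)
    have "invertible ((1 / real (n c)) *\<^sub>R gram (n c) (X c))" using K(3) elim by blast
    then have inv: "invertible (gram (n c) (X c))"
      using scalar_invertible[of "real (n c)" "(1 / real (n c)) *\<^sub>R gram (n c) (X c)"] n by simp
    have Kinv: "norm (matrix_inv (gram (n c) (X c)) *v v) \<le> K / n c * norm v" for v
      using K(4)[OF elim(3)] by (intro norm_matrix_inv_gram_le n inv) auto
    \<comment> \<open>The mean is bounded through \<open>norm v \<le> 1 + (norm v)\<^sup>2\<close> by the trace of the Gram matrix.\<close>
    have T: "norm (xnew c) \<le> T"
    proof -
      have "norm (\<Sum>i<n c. X c i) \<le> (\<Sum>i<n c. 1 + (norm (X c i))\<^sup>2)"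
      proof (rule sum_norm_le)
        fix i show "norm (X c i) \<le> 1 + (norm (X c i))\<^sup>2"
          using zero_le_power2[of "norm (X c i) - 1"] by (simp add: power2_diff) (smt (verit) norm_ge_zero)
      qed
      then have "norm (\<Sum>i<n c. X c i) / n c \<le> 1 + (\<Sum>i<n c. (norm (X c i))\<^sup>2) / n c"
        using n by (simp add: sum.distrib field_simps)
      with elim show ?thesis by (simp add: xnew T_def)
    qed
    have close: "\<bar>?a c i - E c i\<bar> \<le> \<delta>" if "i < n c" "norm (X c i) \<le> R" "\<bar>E c i\<bar> \<le> R" for i
    proof -
      have "\<bar>?a c i - E c i\<bar> \<le> 2 * (K * R ^ 3 / n c + K * T * R\<^sup>2 / n c
          + (1 + K * T * R / n c) * (R * (K * (norm (cross (n c) (X c) (E c)) / n c))))"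
        using elim K(1) that by (intro loo_residual_perturbation[where b = b] n inv Kinv T) auto
      also have "\<dots> \<le> \<delta>" using elim by simp
      finally show ?thesis .
    qed
    have "card {i. i < n c \<and> \<delta> < \<bar>?a c i - E c i\<bar>}
      \<le> card ({i. i < n c \<and> R < \<bar>norm (X c i)\<bar>} \<union> {i. i < n c \<and> R < \<bar>E c i\<bar>})"
    proof (rule card_mono)
      show "{i. i < n c \<and> \<delta> < \<bar>?a c i - E c i\<bar>}
        \<subseteq> {i. i < n c \<and> R < \<bar>norm (X c i)\<bar>} \<union> {i. i < n c \<and> R < \<bar>E c i\<bar>}"
        using close by (auto simp: not_le[symmetric])
    qed simp
    also have "\<dots> \<le> card {i. i < n c \<and> R < \<bar>norm (X c i)\<bar>} + card {i. i < n c \<and> R < \<bar>E c i\<bar>}"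
      by (rule card_Un_le)
    finally have "real (card {i. i < n c \<and> \<delta> < \<bar>?a c i - E c i\<bar>})
      \<le> (\<Sum>i<n c. (norm (X c i))\<^sup>2) / R\<^sup>2 + (\<Sum>i<n c. (E c i)\<^sup>2) / R\<^sup>2"
      using card_large_le[OF R, of "n c" "\<lambda>i. norm (X c i)"] card_large_le[OF R, of "n c" "E c"] by linarith
    then have "far_fraction (n c) (?a c) (E c) \<delta>
      \<le> ((\<Sum>i<n c. (norm (X c i))\<^sup>2) / R\<^sup>2 + (\<Sum>i<n c. (E c i)\<^sup>2) / R\<^sup>2) / n c"
      unfolding far_fraction_def by (intro divide_right_mono) auto
    also have "\<dots> = ((\<Sum>i<n c. (norm (X c i))\<^sup>2) / n c + (\<Sum>i<n c. (E c i)\<^sup>2) / n c) / R\<^sup>2"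
      by (simp add: add_divide_distrib mult.commute)
    also have "\<dots> \<le> C / R\<^sup>2" using elim by (intro divide_right_mono) (auto simp: C_def)
    also have "\<dots> < \<rho>" using R2 \<open>0 < \<rho>\<close> by linarith
    finally have "far_fraction (n c) (?a c) (E c) \<delta> < \<rho>" .
    moreover have "0 \<le> far_fraction (n c) (?a c) (E c) \<delta>" by (simp add: far_fraction_def)
    ultimately show ?case unfolding dist_real_def by simp
  qed
qed

section \<open>Convergence in probability\<close>

context prob_space
begin

text \<open>
  A property of the sample size \<open>n\<close> and the sample point \<open>\<omega>\<close> holds eventually if its
  probability tends to 1. The inner events \<open>A n\<close> make sense of this for properties that are not
  known to be measurable. Convergence along this filter is convergence in probability, so that all
  limit theorems for filters apply.
\<close>

definition high_prob :: "(nat \<times> 'a) filter"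
  where "high_prob = Abs_filter (\<lambda>P. \<exists>A. (\<forall>n. A n \<in> events) \<and> (\<forall>n. \<forall>\<omega>\<in>A n. P (n, \<omega>))
    \<and> (\<lambda>n. prob (A n)) \<longlonglongrightarrow> 1)"

lemma eventually_high_prob:
  "eventually P high_prob \<longleftrightarrow> (\<exists>A. (\<forall>n. A n \<in> events) \<and> (\<forall>n. \<forall>\<omega>\<in>A n. P (n, \<omega>))
    \<and> (\<lambda>n. prob (A n)) \<longlonglongrightarrow> 1)" (is "_ \<longleftrightarrow> ?R P")
  unfolding high_prob_def
proof (rule eventually_Abs_filter, standard)
  show "?R (\<lambda>_. True)" by (rule exI[of _ "\<lambda>_. space M"]) (simp add: prob_space)
next
  fix P Q assume "?R P" "?R Q"
  then obtain A B where A: "\<And>n. A n \<in> events" "\<And>n \<omega>. \<omega> \<in> A n \<Longrightarrow> P (n, \<omega>)" "(\<lambda>n. prob (A n)) \<longlonglongrightarrow> 1"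
    and B: "\<And>n. B n \<in> events" "\<And>n \<omega>. \<omega> \<in> B n \<Longrightarrow> Q (n, \<omega>)" "(\<lambda>n. prob (B n)) \<longlonglongrightarrow> 1"
    by metis
  have "(\<lambda>n. prob (A n) + prob (B n) - 1) \<longlonglongrightarrow> 1 + 1 - 1"
    by (intro tendsto_intros A B)
  then have lim: "(\<lambda>n. prob (A n) + prob (B n) - 1) \<longlonglongrightarrow> 1" by simp
  have "(\<lambda>n. prob (A n \<inter> B n)) \<longlonglongrightarrow> 1"
  proof (rule tendsto_sandwich[OF _ _ lim tendsto_const])
    have "prob (A n) + prob (B n) - 1 \<le> prob (A n \<inter> B n)" for n
      using measure_Un3[of "A n" M "B n"] A(1) B(1) prob_le_1[of "A n \<union> B n"]
      by (simp add: fmeasurable_eq_sets)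
    then show "\<forall>\<^sub>F n in sequentially. prob (A n) + prob (B n) - 1 \<le> prob (A n \<inter> B n)" by simp
  qed auto
  then show "?R (\<lambda>c. P c \<and> Q c)"
    using A B by (intro exI[of _ "\<lambda>n. A n \<inter> B n"]) auto
next
  fix P Q :: "nat \<times> 'a \<Rightarrow> bool" assume "\<forall>c. P c \<longrightarrow> Q c" "?R P"
  then show "?R Q" by blast
qed

lemma filterlim_fst_high_prob: "filterlim fst at_top high_prob"
  unfolding filterlim_at_top
proof
  fix Z :: nat
  have "(\<lambda>n. prob (if Z \<le> n then space M else {})) \<longlonglongrightarrow> 1"
    by (rule tendsto_eventually) (auto simp: prob_space intro: eventually_mono[OF eventually_ge_at_top[of Z]])
  then show "\<forall>\<^sub>F c in high_prob. Z \<le> fst c"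
    unfolding eventually_high_prob
    by (intro exI[of _ "\<lambda>n. if Z \<le> n then space M else {}"]) auto
qed

lemma eventually_snd_in_space: "\<forall>\<^sub>F c in high_prob. snd c \<in> space M"
  unfolding eventually_high_prob by (rule exI[of _ "\<lambda>_. space M"]) (simp add: prob_space)

text \<open>
  Measurability has to be checked only at the very end, when a statement along the filter is turned
  back into one about probabilities.
\<close>

lemma tendsto_prob_one:
  assumes "\<forall>\<^sub>F c in high_prob. P (fst c) (snd c)"
    and "\<forall>\<^sub>F n in sequentially. {\<omega> \<in> space M. P n \<omega>} \<in> events"
  shows "(\<lambda>n. prob {\<omega> \<in> space M. P n \<omega>}) \<longlonglongrightarrow> 1"
proof -
  obtain A where A: "\<And>n. A n \<in> events" "\<And>n \<omega>. \<omega> \<in> A n \<Longrightarrow> P n \<omega>" "(\<lambda>n. prob (A n)) \<longlonglongrightarrow> 1"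
    using assms(1) unfolding eventually_high_prob by auto
  show ?thesis
  proof (rule tendsto_sandwich[OF _ _ A(3) tendsto_const])
    show "\<forall>\<^sub>F n in sequentially. prob (A n) \<le> prob {\<omega> \<in> space M. P n \<omega>}"
      using assms(2)
    proof eventually_elim
      case (elim n)
      then show ?case using A sets.sets_into_space[OF A(1), of n] by (intro finite_measure_mono) auto
    qed
  qed auto
qed

text \<open>
  Chebyshev's inequality: by pairwise independence the second moment of the centred sum grows only
  linearly in \<open>n\<close>.
\<close>

lemma weak_law:
  fixes X :: "nat \<Rightarrow> 'a \<Rightarrow> real"
  assumes indep: "indep_vars (\<lambda>_. borel) X UNIV"
    and sq: "\<And>i. integrable M (\<lambda>\<omega>. (X i \<omega>)\<^sup>2)"
    and mean: "\<And>i. expectation (X i) = \<mu>" and second: "\<And>i. expectation (\<lambda>\<omega>. (X i \<omega>)\<^sup>2) = s"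
  shows "((\<lambda>c. (\<Sum>i<fst c. X i (snd c)) / real (fst c)) \<longlongrightarrow> \<mu>) high_prob"
proof (rule tendstoI)
  fix \<epsilon> :: real assume \<epsilon>: "0 < \<epsilon>"
  have [measurable]: "X i \<in> borel_measurable M" for i using indep by (auto simp: indep_vars_def)
  have int: "integrable M (X i)" for i using square_integrable_imp_integrable[OF _ sq] by simp
  define Z where "Z i \<omega> = X i \<omega> - \<mu>" for i \<omega>
  have [measurable]: "Z i \<in> borel_measurable M" for i by (simp add: Z_def[abs_def])
  have Zint: "integrable M (Z i)" for i unfolding Z_def[abs_def] using int by simp
  have Z0: "expectation (Z i) = 0" for i
    unfolding Z_def[abs_def] using int mean by (simp add: prob_space)
  have "indep_vars (\<lambda>_. borel) (\<lambda>i \<omega>. (\<lambda>t. t - \<mu>) (X i \<omega>)) UNIV"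
    by (rule indep_vars_compose2[OF indep]) simp
  then have Zindep: "indep_vars (\<lambda>_. borel) Z UNIV" by (simp add: Z_def[abs_def])
  have Zsq: "integrable M (\<lambda>\<omega>. Z i \<omega> * Z i \<omega>)" "expectation (\<lambda>\<omega>. Z i \<omega> * Z i \<omega>) = s - \<mu>\<^sup>2" for i
  proof -
    have eq: "(\<lambda>\<omega>. Z i \<omega> * Z i \<omega>) = (\<lambda>\<omega>. (X i \<omega>)\<^sup>2 - 2 * \<mu> * X i \<omega> + \<mu>\<^sup>2)"
      by (auto simp: Z_def power2_eq_square algebra_simps)
    show "integrable M (\<lambda>\<omega>. Z i \<omega> * Z i \<omega>)" unfolding eq using sq int by simp
    show "expectation (\<lambda>\<omega>. Z i \<omega> * Z i \<omega>) = s - \<mu>\<^sup>2"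
      unfolding eq using sq int mean second by (simp add: prob_space power2_eq_square)
  qed
  have Zij: "integrable M (\<lambda>\<omega>. Z i \<omega> * Z j \<omega>)" "expectation (\<lambda>\<omega>. Z i \<omega> * Z j \<omega>) = 0" if "i \<noteq> j" for i j
  proof -
    have *: "indep_vars (\<lambda>_. borel) Z {i, j}" by (rule indep_vars_subset[OF Zindep]) simp
    show "integrable M (\<lambda>\<omega>. Z i \<omega> * Z j \<omega>)"
      using indep_vars_integrable[OF _ * Zint] that by simp
    show "expectation (\<lambda>\<omega>. Z i \<omega> * Z j \<omega>) = 0"
      using indep_vars_lebesgue_integral[OF _ * Zint] that Z0 by simp
  qed
  have ZZ: "integrable M (\<lambda>\<omega>. Z i \<omega> * Z j \<omega>)" for i j using Zsq Zij by (cases "i = j") auto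
  have sumsq: "integrable M (\<lambda>\<omega>. (\<Sum>i<n. Z i \<omega>)\<^sup>2)" "expectation (\<lambda>\<omega>. (\<Sum>i<n. Z i \<omega>)\<^sup>2) = real n * (s - \<mu>\<^sup>2)" for n
  proof -
    have eq: "(\<lambda>\<omega>. (\<Sum>i<n. Z i \<omega>)\<^sup>2) = (\<lambda>\<omega>. \<Sum>i<n. \<Sum>j<n. Z i \<omega> * Z j \<omega>)"
      by (simp add: power2_eq_square sum_product)
    show "integrable M (\<lambda>\<omega>. (\<Sum>i<n. Z i \<omega>)\<^sup>2)" unfolding eq using ZZ by simp
    have "expectation (\<lambda>\<omega>. (\<Sum>i<n. Z i \<omega>)\<^sup>2) = (\<Sum>i<n. \<Sum>j<n. expectation (\<lambda>\<omega>. Z i \<omega> * Z j \<omega>))"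
      unfolding eq using ZZ by simp
    also have "\<dots> = (\<Sum>i<n. \<Sum>j<n. if j = i then s - \<mu>\<^sup>2 else 0)"
      using Zsq Zij by (intro sum.cong) auto
    finally show "expectation (\<lambda>\<omega>. (\<Sum>i<n. Z i \<omega>)\<^sup>2) = real n * (s - \<mu>\<^sup>2)" by simp
  qed
  define A where "A n = {\<omega> \<in> space M. \<bar>\<Sum>i<n. Z i \<omega>\<bar> < real n * \<epsilon>}" for n
  have A: "A n \<in> events" for n unfolding A_def by measurable
  have lower: "1 - (s - \<mu>\<^sup>2) / \<epsilon>\<^sup>2 / real n \<le> prob (A n)" if "0 < n" for n
  proof -
    have "prob {\<omega> \<in> space M. real n * \<epsilon> \<le> \<bar>\<Sum>i<n. Z i \<omega>\<bar>} \<le> expectation (\<lambda>\<omega>. (\<Sum>i<n. Z i \<omega>)\<^sup>2) / (real n * \<epsilon>)\<^sup>2"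
      using sumsq that \<epsilon> by (intro second_moment_method) auto
    also have "\<dots> = (s - \<mu>\<^sup>2) / \<epsilon>\<^sup>2 / real n"
      using that unfolding sumsq(2) by (simp add: power2_eq_square)
    also have "{\<omega> \<in> space M. real n * \<epsilon> \<le> \<bar>\<Sum>i<n. Z i \<omega>\<bar>} = space M - A n" by (auto simp: A_def)
    finally show ?thesis using prob_compl[OF A, of n] by simp
  qed
  have "(\<lambda>n. 1 - (s - \<mu>\<^sup>2) / \<epsilon>\<^sup>2 / real n) \<longlonglongrightarrow> 1 - 0"
    by (intro tendsto_diff tendsto_const lim_const_over_n)
  then have lim: "(\<lambda>n. 1 - (s - \<mu>\<^sup>2) / \<epsilon>\<^sup>2 / real n) \<longlonglongrightarrow> 1" by simp
  have "(\<lambda>n. prob (A n)) \<longlonglongrightarrow> 1"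
  proof (rule tendsto_sandwich[OF _ _ lim tendsto_const])
    show "\<forall>\<^sub>F n in sequentially. 1 - (s - \<mu>\<^sup>2) / \<epsilon>\<^sup>2 / real n \<le> prob (A n)"
      using lower by (rule eventually_mono[OF eventually_gt_at_top[of 0]])
  qed auto
  moreover have "dist ((\<Sum>i<n. X i \<omega>) / real n) \<mu> < \<epsilon>" if "\<omega> \<in> A n" for n \<omega>
  proof -
    have n: "0 < n" using that by (cases n) (auto simp: A_def)
    have "(\<Sum>i<n. X i \<omega>) / real n - \<mu> = (\<Sum>i<n. Z i \<omega>) / real n"
      using n by (simp add: Z_def sum_subtractf field_simps)
    then show ?thesis using that n by (simp add: A_def dist_real_def field_simps)
  qed
  ultimately show "\<forall>\<^sub>F c in high_prob. dist ((\<Sum>i<fst c. X i (snd c)) / real (fst c)) \<mu> < \<epsilon>"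
    unfolding eventually_high_prob using A by (intro exI[of _ A]) auto
qed

lemma weak_law_iid:
  fixes f :: "'b \<Rightarrow> real"
  assumes indep: "indep_vars (\<lambda>_. S) X UNIV" and id: "\<And>i. distr M S (X i) = distr M S (X 0)"
    and f [measurable]: "f \<in> borel_measurable S" and sq: "integrable M (\<lambda>\<omega>. (f (X 0 \<omega>))\<^sup>2)"
  shows "((\<lambda>c. (\<Sum>i<fst c. f (X i (snd c))) / real (fst c)) \<longlongrightarrow> expectation (\<lambda>\<omega>. f (X 0 \<omega>))) high_prob"
proof (rule weak_law)
  have [measurable]: "X i \<in> M \<rightarrow>\<^sub>M S" for i using indep by (auto simp: indep_vars_def)
  show "indep_vars (\<lambda>_. borel) (\<lambda>i \<omega>. f (X i \<omega>)) UNIV" by (rule indep_vars_compose2[OF indep f])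
  have eq: "expectation (\<lambda>\<omega>. g (X i \<omega>)) = expectation (\<lambda>\<omega>. g (X 0 \<omega>))"
    "integrable M (\<lambda>\<omega>. g (X i \<omega>)) \<longleftrightarrow> integrable M (\<lambda>\<omega>. g (X 0 \<omega>))"
    if [measurable]: "g \<in> borel_measurable S" for g :: "'b \<Rightarrow> real" and i
    using integral_distr[of "X i" M S g] integral_distr[of "X 0" M S g]
      integrable_distr_eq[of "X i" M S g] integrable_distr_eq[of "X 0" M S g] id[of i] by simp_all
  show "integrable M (\<lambda>\<omega>. (f (X i \<omega>))\<^sup>2)" for i using eq(2)[of "\<lambda>p. (f p)\<^sup>2" i] sq by simp
  show "expectation (\<lambda>\<omega>. f (X i \<omega>)) = expectation (\<lambda>\<omega>. f (X 0 \<omega>))" for i by (rule eq(1)) simp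
  show "expectation (\<lambda>\<omega>. (f (X i \<omega>))\<^sup>2) = expectation (\<lambda>\<omega>. (f (X 0 \<omega>))\<^sup>2)" for i
    by (rule eq(1)[of "\<lambda>p. (f p)\<^sup>2"]) simp
qed

section \<open>Two independent sequences as one sequence of pairs\<close>

text \<open>
  The independence of two whole sequences is given through the \<open>\<sigma>\<close>-algebras generated by the
  sequences as functions into a product space. The following lemmas extract what it says about
  single coordinates.
\<close>

lemma vimage_in_sequence_algebra:
  assumes Z: "\<And>i. Z i \<in> M \<rightarrow>\<^sub>M L" and A: "A \<in> sets L"
  shows "Z j -` A \<inter> space M \<in> sets (vimage_algebra (space M) (\<lambda>\<omega> i. Z i \<omega>) (PiM UNIV (\<lambda>_. L)))"
proof -
  have "(\<lambda>\<omega> i. Z i \<omega>) -` {f \<in> space (PiM UNIV (\<lambda>_. L)). f j \<in> A} \<inter> space M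
    \<in> sets (vimage_algebra (space M) (\<lambda>\<omega> i. Z i \<omega>) (PiM UNIV (\<lambda>_. L)))"
    using A by (intro in_vimage_algebra) simp
  also have "(\<lambda>\<omega> i. Z i \<omega>) -` {f \<in> space (PiM UNIV (\<lambda>_. L)). f j \<in> A} \<inter> space M = Z j -` A \<inter> space M"
    using measurable_space[OF Z] by (auto simp: space_PiM)
  finally show ?thesis .
qed

lemma indep_var_of_indep_sequences:
  assumes X: "\<And>i. X i \<in> M \<rightarrow>\<^sub>M S" and Y: "\<And>i. Y i \<in> M \<rightarrow>\<^sub>M T"
    and XY: "indep_set (sets (vimage_algebra (space M) (\<lambda>\<omega> i. X i \<omega>) (PiM UNIV (\<lambda>_. S))))
      (sets (vimage_algebra (space M) (\<lambda>\<omega> i. Y i \<omega>) (PiM UNIV (\<lambda>_. T))))"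
    and f: "f \<in> S \<rightarrow>\<^sub>M K" and g: "g \<in> T \<rightarrow>\<^sub>M K"
  shows "indep_var K (\<lambda>\<omega>. f (X i \<omega>)) K (\<lambda>\<omega>. g (Y j \<omega>))"
  unfolding indep_var_eq
proof (intro conjI measurable_compose[OF X f] measurable_compose[OF Y g])
  have sub: "sigma_sets (space M) {(\<lambda>\<omega>. h (Z k \<omega>)) -` A \<inter> space M | A. A \<in> sets K}
      \<subseteq> sets (vimage_algebra (space M) (\<lambda>\<omega> i. Z i \<omega>) (PiM UNIV (\<lambda>_. L)))"
    if Z: "\<And>i. Z i \<in> M \<rightarrow>\<^sub>M L" and h: "h \<in> L \<rightarrow>\<^sub>M K" for Z :: "'i \<Rightarrow> 'a \<Rightarrow> 'z" and L h k
  proof -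
    have "(\<lambda>\<omega>. h (Z k \<omega>)) -` A \<inter> space M \<in> sets (vimage_algebra (space M) (\<lambda>\<omega> i. Z i \<omega>) (PiM UNIV (\<lambda>_. L)))"
      if "A \<in> sets K" for A
    proof -
      have "(\<lambda>\<omega>. h (Z k \<omega>)) -` A \<inter> space M = Z k -` (h -` A \<inter> space L) \<inter> space M"
        using measurable_space[OF Z] by auto
      then show ?thesis
        using vimage_in_sequence_algebra[where Z = Z and L = L, OF Z measurable_sets[OF h that]] by simp
    qed
    then have "{(\<lambda>\<omega>. h (Z k \<omega>)) -` A \<inter> space M | A. A \<in> sets K}
      \<subseteq> sets (vimage_algebra (space M) (\<lambda>\<omega> i. Z i \<omega>) (PiM UNIV (\<lambda>_. L)))"
      by auto
    from sets.sigma_sets_subset[OF this] show ?thesis by simp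
  qed
  show "indep_set (sigma_sets (space M) {(\<lambda>\<omega>. f (X i \<omega>)) -` A \<inter> space M | A. A \<in> sets K})
     (sigma_sets (space M) {(\<lambda>\<omega>. g (Y j \<omega>)) -` A \<inter> space M | A. A \<in> sets K})"
    using XY unfolding indep_set_def
    by (rule indep_sets_mono_sets) (use sub[of X, OF X f] sub[of Y, OF Y g] in \<open>auto split: bool.split\<close>)
qed

lemma distr_Pair_of_indep_sequences:
  assumes X: "\<And>i. X i \<in> M \<rightarrow>\<^sub>M S" and Y: "\<And>i. Y i \<in> M \<rightarrow>\<^sub>M T"
    and XY: "indep_set (sets (vimage_algebra (space M) (\<lambda>\<omega> i. X i \<omega>) (PiM UNIV (\<lambda>_. S))))
      (sets (vimage_algebra (space M) (\<lambda>\<omega> i. Y i \<omega>) (PiM UNIV (\<lambda>_. T))))"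
  shows "distr M (S \<Otimes>\<^sub>M T) (\<lambda>\<omega>. (X i \<omega>, Y j \<omega>)) = distr M S (X i) \<Otimes>\<^sub>M distr M T (Y j)"
proof (rule pair_measure_eqI[symmetric])
  interpret X: prob_space "distr M S (X i)" using X by (rule prob_space_distr)
  interpret Y: prob_space "distr M T (Y j)" using Y by (rule prob_space_distr)
  show "sigma_finite_measure (distr M S (X i))" "sigma_finite_measure (distr M T (Y j))"
    by unfold_locales
  fix A B assume "A \<in> sets (distr M S (X i))" "B \<in> sets (distr M T (Y j))"
  then have A: "A \<in> sets S" and B: "B \<in> sets T" by simp_all
  have "prob ((X i -` A \<inter> space M) \<inter> (Y j -` B \<inter> space M))
    = prob (X i -` A \<inter> space M) * prob (Y j -` B \<inter> space M)"
    by (rule indep_setD[OF XY vimage_in_sequence_algebra vimage_in_sequence_algebra]) (simp_all add: X Y A B)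
  moreover have "(X i -` A \<inter> space M) \<inter> (Y j -` B \<inter> space M) = (\<lambda>\<omega>. (X i \<omega>, Y j \<omega>)) -` (A \<times> B) \<inter> space M"
    by auto
  ultimately show "emeasure (distr M S (X i)) A * emeasure (distr M T (Y j)) B
      = emeasure (distr M (S \<Otimes>\<^sub>M T) (\<lambda>\<omega>. (X i \<omega>, Y j \<omega>))) (A \<times> B)"
    using A B X[of i] Y[of j]
    by (simp add: emeasure_distr measurable_Pair emeasure_eq_measure ennreal_mult')
qed simp

text \<open>
  The events \<open>X i \<in> A \<and> Y i \<in> B\<close> are stable under intersection and generate the \<open>\<sigma>\<close>-algebra of
  the \<open>i\<close>-th pair. On finite intersections of them the probability factorises first into an
  \<open>X\<close>-part and a \<open>Y\<close>-part and then over the indices.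
\<close>

lemma indep_vars_Pair:
  assumes X: "indep_vars (\<lambda>_. S) X UNIV" and Y: "indep_vars (\<lambda>_. T) Y UNIV"
    and XY: "indep_set (sets (vimage_algebra (space M) (\<lambda>\<omega> i. X i \<omega>) (PiM UNIV (\<lambda>_. S))))
      (sets (vimage_algebra (space M) (\<lambda>\<omega> i. Y i \<omega>) (PiM UNIV (\<lambda>_. T))))"
  shows "indep_vars (\<lambda>_. S \<Otimes>\<^sub>M T) (\<lambda>i \<omega>. (X i \<omega>, Y i \<omega>)) UNIV"
proof -
  have Xm [measurable]: "X i \<in> M \<rightarrow>\<^sub>M S" and Ym [measurable]: "Y i \<in> M \<rightarrow>\<^sub>M T" for i
    using X Y by (auto simp: indep_vars_def)
  define G where "G i = {(X i -` A \<inter> space M) \<inter> (Y i -` B \<inter> space M) | A B. A \<in> sets S \<and> B \<in> sets T}" for i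
  have "indep_sets G UNIV"
  proof (rule indep_setsI)
    show "G i \<subseteq> events" for i by (auto simp: G_def)
    fix C J assume J: "J \<noteq> {}" "finite J" and C: "\<forall>j\<in>J. C j \<in> G j"
    have "\<forall>j\<in>J. \<exists>p. fst p \<in> sets S \<and> snd p \<in> sets T
        \<and> C j = (X j -` fst p \<inter> space M) \<inter> (Y j -` snd p \<inter> space M)"
    proof
      fix j assume "j \<in> J"
      then have "C j \<in> G j" using C by blast
      then obtain A B where "A \<in> sets S" "B \<in> sets T" "C j = (X j -` A \<inter> space M) \<inter> (Y j -` B \<inter> space M)"
        unfolding G_def by blast
      then show "\<exists>p. fst p \<in> sets S \<and> snd p \<in> sets T
        \<and> C j = (X j -` fst p \<inter> space M) \<inter> (Y j -` snd p \<inter> space M)"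
        by (intro exI[of _ "(A, B)"]) simp
    qed
    from bchoice[OF this] obtain p where "\<forall>j\<in>J. fst (p j) \<in> sets S \<and> snd (p j) \<in> sets T
        \<and> C j = (X j -` fst (p j) \<inter> space M) \<inter> (Y j -` snd (p j) \<inter> space M)" ..
    then obtain A B where AB: "\<And>j. j \<in> J \<Longrightarrow> A j \<in> sets S" "\<And>j. j \<in> J \<Longrightarrow> B j \<in> sets T"
      "\<And>j. j \<in> J \<Longrightarrow> C j = (X j -` A j \<inter> space M) \<inter> (Y j -` B j \<inter> space M)"
      by (rule_tac that[of "\<lambda>j. fst (p j)" "\<lambda>j. snd (p j)"]) simp_all
    have split: "prob (\<Inter>j\<in>K. C j) = prob (\<Inter>j\<in>K. X j -` A j \<inter> space M) * prob (\<Inter>j\<in>K. Y j -` B j \<inter> space M)"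
      if K: "K \<subseteq> J" "K \<noteq> {}" for K
    proof -
      have "finite K" using K J finite_subset by blast
      have "(\<Inter>j\<in>K. C j) = (\<Inter>j\<in>K. X j -` A j \<inter> space M) \<inter> (\<Inter>j\<in>K. Y j -` B j \<inter> space M)"
        using AB(3) K by (auto simp: subset_iff)
      also have "prob \<dots> = prob (\<Inter>j\<in>K. X j -` A j \<inter> space M) * prob (\<Inter>j\<in>K. Y j -` B j \<inter> space M)"
        using K AB \<open>finite K\<close>
        by (intro indep_setD[OF XY] sets.finite_INT vimage_in_sequence_algebra Xm Ym) auto
      finally show ?thesis .
    qed
    have "prob (\<Inter>j\<in>J. X j -` A j \<inter> space M) = (\<Prod>j\<in>J. prob (X j -` A j \<inter> space M))"
      using J AB by (intro indep_varsD[OF X]) auto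
    moreover have "prob (\<Inter>j\<in>J. Y j -` B j \<inter> space M) = (\<Prod>j\<in>J. prob (Y j -` B j \<inter> space M))"
      using J AB by (intro indep_varsD[OF Y]) auto
    ultimately have "prob (\<Inter>j\<in>J. C j)
      = (\<Prod>j\<in>J. prob (X j -` A j \<inter> space M)) * (\<Prod>j\<in>J. prob (Y j -` B j \<inter> space M))"
      using split[OF subset_refl J(1)] by metis
    also have "\<dots> = (\<Prod>j\<in>J. prob (C j))"
      unfolding prod.distrib[symmetric] by (rule prod.cong) (use split[of "{_}"] in auto)
    finally show "prob (\<Inter>j\<in>J. C j) = (\<Prod>j\<in>J. prob (C j))" .
  qed
  moreover have "Int_stable (G i)" for i
  proof (rule Int_stableI)
    fix a b assume "a \<in> G i" "b \<in> G i"
    then obtain A B A' B' where "A \<in> sets S" "B \<in> sets T" "A' \<in> sets S" "B' \<in> sets T"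
      "a = (X i -` A \<inter> space M) \<inter> (Y i -` B \<inter> space M)" "b = (X i -` A' \<inter> space M) \<inter> (Y i -` B' \<inter> space M)"
      unfolding G_def by blast
    then show "a \<inter> b \<in> G i"
      unfolding G_def by (intro CollectI exI[of _ "A \<inter> A'"] exI[of _ "B \<inter> B'"]) auto
  qed
  ultimately have ind: "indep_sets (\<lambda>i. sigma_sets (space M) (G i)) UNIV"
    by (rule indep_sets_sigma)
  have "(\<lambda>\<omega>. (X i \<omega>, Y i \<omega>)) -` C \<inter> space M \<in> sigma_sets (space M) (G i)" if C: "C \<in> sets (S \<Otimes>\<^sub>M T)" for i C
  proof -
    define N where "N = sigma (space M) (G i)"
    have "G i \<subseteq> Pow (space M)" by (auto simp: G_def)
    then have N: "space N = space M" "sets N = sigma_sets (space M) (G i)" by (simp_all add: N_def)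
    have "X i \<in> N \<rightarrow>\<^sub>M S"
    proof (rule measurableI)
      fix A assume "A \<in> sets S"
      then have "X i -` A \<inter> space M \<in> G i"
        unfolding G_def using measurable_space[OF Ym] by (intro CollectI exI[of _ A] exI[of _ "space T"]) auto
      then show "X i -` A \<inter> space N \<in> sets N" by (simp add: N)
    qed (use measurable_space[OF Xm] in \<open>simp add: N\<close>)
    moreover have "Y i \<in> N \<rightarrow>\<^sub>M T"
    proof (rule measurableI)
      fix B assume "B \<in> sets T"
      then have "Y i -` B \<inter> space M \<in> G i"
        unfolding G_def using measurable_space[OF Xm] by (intro CollectI exI[of _ "space S"] exI[of _ B]) auto
      then show "Y i -` B \<inter> space N \<in> sets N" by (simp add: N)
    qed (use measurable_space[OF Ym] in \<open>simp add: N\<close>)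
    ultimately have "(\<lambda>\<omega>. (X i \<omega>, Y i \<omega>)) \<in> N \<rightarrow>\<^sub>M S \<Otimes>\<^sub>M T" by (rule measurable_Pair)
    from measurable_sets[OF this C] show ?thesis by (simp add: N)
  qed
  then show ?thesis
    unfolding indep_vars_def2 by (intro conjI indep_sets_mono_sets[OF ind]) auto
qed

lemma iid_compose:
  assumes indep: "indep_vars (\<lambda>_. S) X UNIV" and id: "\<And>i::nat. distr M S (X i) = distr M S (X 0)"
    and f: "f \<in> S \<rightarrow>\<^sub>M T"
  shows "indep_vars (\<lambda>_. T) (\<lambda>i \<omega>. f (X i \<omega>)) UNIV"
    and "distr M T (\<lambda>\<omega>. f (X i \<omega>)) = distr M T (\<lambda>\<omega>. f (X 0 \<omega>))"
proof -
  show "indep_vars (\<lambda>_. T) (\<lambda>i \<omega>. f (X i \<omega>)) UNIV" by (rule indep_vars_compose2[OF indep f])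
  have X: "X i \<in> M \<rightarrow>\<^sub>M S" for i using indep by (auto simp: indep_vars_def)
  have "distr M T (\<lambda>\<omega>. f (X i \<omega>)) = distr (distr M S (X i)) T f" for i
    by (simp add: distr_distr[OF f X] comp_def)
  then show "distr M T (\<lambda>\<omega>. f (X i \<omega>)) = distr M T (\<lambda>\<omega>. f (X 0 \<omega>))" by (simp add: id[of i])
qed

end

section \<open>Normal distributions\<close>

text \<open>
  The density is positive, so every nondegenerate interval has positive mass.
\<close>

lemma cdf_std_normal_strict_mono:
  assumes "s < t"
  shows "cdf std_normal_distribution s < cdf std_normal_distribution t"
proof -
  interpret real_distribution std_normal_distribution by (rule real_dist_normal_dist)
  have not_std_le: "\<not> std_normal_density x \<le> 0" for x
    using normal_density_pos[of 1 0 x] by linarith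
  have "measure std_normal_distribution {s<..t} \<noteq> 0"
  proof
    assume "measure std_normal_distribution {s<..t} = 0"
    then have "emeasure std_normal_distribution {s<..t} = 0" by (simp add: emeasure_eq_measure)
    then have "{s<..t} \<in> null_sets (density lborel (\<lambda>x. ennreal (std_normal_density x)))"
      by (auto simp: null_sets_def)
    then have "AE x in lborel. x \<in> {s<..t} \<longrightarrow> ennreal (std_normal_density x) = 0"
      by (simp add: null_sets_density_iff)
    then have "AE x in lborel. x \<notin> {s<..t}"
      by eventually_elim (auto simp: ennreal_eq_0_iff not_std_le)
    then have "emeasure lborel {s<..t} = 0"
      by (subst (asm) AE_iff_measurable[OF _ refl]) (auto simp: greaterThanAtMost_def greaterThan_def atMost_def Collect_conj_eq)
    then show False using assms by simp
  qed
  then have "0 < measure std_normal_distribution {s<..t}" by (simp add: zero_less_measure_iff)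
  with cdf_diff_eq[OF assms] show ?thesis by simp
qed

lemma std_normal_quantile_exists:
  assumes "0 < \<tau>" "\<tau> < 1"
  obtains q where "cdf std_normal_distribution q = \<tau>"
proof -
  interpret real_distribution std_normal_distribution by (rule real_dist_normal_dist)
  have "emeasure std_normal_distribution {x} = 0" for x
    by (subst emeasure_density) (auto simp: nn_integral_0_iff_AE intro!: AE_I[of _ _ "{x}"] split: split_indicator)
  then have cont: "isCont (cdf std_normal_distribution) x" for x
    by (simp add: isCont_cdf measure_def)
  have "\<forall>\<^sub>F t in at_bot. cdf std_normal_distribution t < \<tau>"
    using order_tendstoD(2)[OF cdf_lim_at_bot assms(1)] .
  then obtain a where a: "cdf std_normal_distribution a < \<tau>"
    by (meson eventually_happens' trivial_limit_at_bot_linorder)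
  have "\<forall>\<^sub>F t in at_top. \<tau> < cdf std_normal_distribution t"
    using order_tendstoD(1)[OF cdf_lim_at_top_prob assms(2)] .
  then obtain b where b: "\<tau> < cdf std_normal_distribution b"
    by (meson eventually_happens' trivial_limit_at_top_linorder)
  have "a \<le> b"
  proof (rule ccontr)
    assume "\<not> a \<le> b"
    then show False using cdf_nondecreasing[of b a] a b by simp
  qed
  then obtain q where "cdf std_normal_distribution q = \<tau>"
    using IVT[of "cdf std_normal_distribution" a \<tau> b] a b cont by auto
  then show ?thesis by (rule that)
qed

text \<open>
  The known moments of the normal density are the central ones; they are moved to the origin by
  \<open>t\<^sup>4 \<le> 8 (t - m)\<^sup>4 + 8 m\<^sup>4\<close>.
\<close>

lemma integrable_normal_law_power4:
  assumes "normal_law L"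
  shows "integrable L (\<lambda>t. t ^ 4)"
  using assms unfolding normal_law_def
proof (elim disjE exE conjE)
  fix m assume L: "L = return borel m"
  interpret prob_space L unfolding L by (rule prob_space_return) simp
  have "AE t in L. norm (t ^ 4) \<le> m ^ 4" unfolding L by (simp add: AE_return)
  then show ?thesis by (intro integrable_const_bound[of _ "m ^ 4"]) (simp_all add: L)
next
  fix m s :: real assume s: "0 < s" and L: "L = density lborel (\<lambda>t. ennreal (normal_density m s t))"
  interpret prob_space L unfolding L using prob_space_normal_density[OF s] .
  have [measurable_cong]: "sets L = sets borel" by (simp add: L)
  have "integrable L (\<lambda>t. (t - m) ^ 4)"
    unfolding L using integrable_normal_moment[where \<mu> = m and \<sigma> = s and k = 4] s by (subst integrable_density) auto
  then have "integrable L (\<lambda>t. 8 * (t - m) ^ 4 + 8 * m ^ 4)" by simp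
  then show ?thesis
  proof (rule Bochner_Integration.integrable_bound)
    have sq: "(a + b)\<^sup>2 \<le> 2 * (a\<^sup>2 + b\<^sup>2)" for a b :: real
      using sum_squares_bound[of a b] by (simp add: power2_sum)
    have "t ^ 4 \<le> 8 * (t - m) ^ 4 + 8 * m ^ 4" for t
    proof -
      have "(t ^ 2)\<^sup>2 \<le> (2 * ((t - m)\<^sup>2 + m\<^sup>2))\<^sup>2"
        using zero_le_power2[of "t - 2 * m"] by (intro power_mono) (auto simp: power2_eq_square algebra_simps)
      also have "\<dots> = 4 * ((t - m)\<^sup>2 + m\<^sup>2)\<^sup>2" by (simp only: power_mult_distrib) simp
      also have "((t - m)\<^sup>2 + m\<^sup>2)\<^sup>2 \<le> 2 * (((t - m)\<^sup>2)\<^sup>2 + (m\<^sup>2)\<^sup>2)"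
        by (rule sq)
      finally show ?thesis by simp
    qed
    then show "AE t in L. norm (t ^ 4) \<le> norm (8 * (t - m) ^ 4 + 8 * m ^ 4)" by simp
  qed simp
qed

context prob_space
begin

text \<open>
  The weak law is applied to products of two normal variables, whose second moments are controlled
  by the fourth moments of the factors.
\<close>

definition fourth_moment :: "('a \<Rightarrow> real) \<Rightarrow> bool"
  where "fourth_moment X \<longleftrightarrow> X \<in> borel_measurable M \<and> integrable M (\<lambda>\<omega>. X \<omega> ^ 4)"

lemma fourth_moment_normal:
  assumes "X \<in> borel_measurable M" "normal_law (distr M borel X)"
  shows "fourth_moment X"
  using integrable_normal_law_power4[OF assms(2)] assms(1)
  by (simp add: fourth_moment_def integrable_distr_eq)

lemma fourth_moment_product:
  assumes "fourth_moment X" "fourth_moment Y"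
  shows "integrable M (\<lambda>\<omega>. (X \<omega> * Y \<omega>)\<^sup>2)" "integrable M (\<lambda>\<omega>. X \<omega> * Y \<omega>)"
proof -
  have [measurable]: "X \<in> borel_measurable M" "Y \<in> borel_measurable M"
    using assms by (auto simp: fourth_moment_def)
  have "integrable M (\<lambda>\<omega>. X \<omega> ^ 4 + Y \<omega> ^ 4)" using assms by (simp add: fourth_moment_def)
  then show sq: "integrable M (\<lambda>\<omega>. (X \<omega> * Y \<omega>)\<^sup>2)"
  proof (rule Bochner_Integration.integrable_bound)
    have "(a * b)\<^sup>2 \<le> a ^ 4 + b ^ 4" for a b :: real
    proof -
      have "2 * (a\<^sup>2 * b\<^sup>2) \<le> (a\<^sup>2)\<^sup>2 + (b\<^sup>2)\<^sup>2" using sum_squares_bound[of "a\<^sup>2" "b\<^sup>2"] by simp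
      moreover have "0 \<le> a\<^sup>2 * b\<^sup>2" by simp
      ultimately have "a\<^sup>2 * b\<^sup>2 \<le> (a\<^sup>2)\<^sup>2 + (b\<^sup>2)\<^sup>2" by linarith
      then show ?thesis by (simp add: power_mult_distrib)
    qed
    then show "AE \<omega> in M. norm ((X \<omega> * Y \<omega>)\<^sup>2) \<le> norm (X \<omega> ^ 4 + Y \<omega> ^ 4)" by simp
  qed simp
  show "integrable M (\<lambda>\<omega>. X \<omega> * Y \<omega>)" by (rule square_integrable_imp_integrable[OF _ sq]) simp
qed

lemma fourth_moment_integrable:
  assumes "fourth_moment X" shows "integrable M X" "integrable M (\<lambda>\<omega>. (X \<omega>)\<^sup>2)"
proof -
  have "fourth_moment (\<lambda>_. 1)" by (simp add: fourth_moment_def)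
  then show "integrable M X" using fourth_moment_product(2)[OF assms, of "\<lambda>_. 1"] by simp
  show "integrable M (\<lambda>\<omega>. (X \<omega>)\<^sup>2)" using fourth_moment_product(2)[OF assms assms] by (simp add: power2_eq_square)
qed

lemma prob_normal_le:
  assumes X: "distributed M lborel X (\<lambda>t. ennreal (normal_density m s t))" and s: "0 < s"
  shows "prob {\<omega> \<in> space M. X \<omega> \<le> t} = cdf std_normal_distribution ((t - m) / s)"
proof -
  have [measurable]: "X \<in> borel_measurable M" using distributed_measurable[OF X] by simp
  have "distributed M lborel (\<lambda>\<omega>. (X \<omega> - m) / s) (\<lambda>t. ennreal (std_normal_density t))"
    using X normal_standard_normal_convert[OF s] by simp
  then have "distr M lborel (\<lambda>\<omega>. (X \<omega> - m) / s) = std_normal_distribution"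
    by (rule distributed_distr_eq_density)
  then have "cdf std_normal_distribution ((t - m) / s)
    = measure (distr M lborel (\<lambda>\<omega>. (X \<omega> - m) / s)) {..(t - m) / s}" by (simp add: cdf_def)
  also have "\<dots> = prob ((\<lambda>\<omega>. (X \<omega> - m) / s) -` {..(t - m) / s} \<inter> space M)"
    by (intro measure_distr) auto
  also have "(\<lambda>\<omega>. (X \<omega> - m) / s) -` {..(t - m) / s} \<inter> space M = {\<omega> \<in> space M. X \<omega> \<le> t}"
    using s by (auto simp: field_simps)
  finally show ?thesis ..
qed

end

section \<open>Measurability of the statistics\<close>

lemma borel_measurable_vec_nth [measurable (raw)]:
  fixes f :: "'b \<Rightarrow> real ^ 'd::finite"
  assumes "f \<in> borel_measurable L"
  shows "(\<lambda>x. f x $ j) \<in> borel_measurable L"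
  by (rule measurable_compose[OF assms]) (intro borel_measurable_continuous_onI continuous_intros)

lemma borel_measurable_vecI:
  fixes f :: "'b \<Rightarrow> 'c::euclidean_space ^ 'd::finite"
  assumes "\<And>j. (\<lambda>x. f x $ j) \<in> borel_measurable L"
  shows "f \<in> borel_measurable L"
  unfolding borel_measurable_euclidean_space[of f]
  using assms by (auto simp: Basis_vec_def inner_axis intro!: borel_measurable_inner)

lemma borel_measurable_det:
  fixes A :: "'b \<Rightarrow> real ^ 'd::finite ^ 'd"
  assumes "\<And>i j. (\<lambda>x. A x $ i $ j) \<in> borel_measurable L"
  shows "(\<lambda>x. det (A x)) \<in> borel_measurable L"
  unfolding det_def using assms by (intro borel_measurable_sum borel_measurable_times borel_measurable_prod) auto

text \<open>
  The matrix inverse is a choice operator. On singular matrices nothing satisfies its specification,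
  so that it takes one fixed value there; on the others it is given by Cramer's rule, a quotient of
  polynomials in the entries.
\<close>

lemma borel_measurable_matrix_inv_mult:
  fixes A :: "'b \<Rightarrow> real ^ 'd::finite ^ 'd"
  assumes [measurable]: "\<And>i j. (\<lambda>x. A x $ i $ j) \<in> borel_measurable L" "\<And>j. (\<lambda>x. b x $ j) \<in> borel_measurable L"
  shows "(\<lambda>x. (matrix_inv (A x) *v b x) $ k) \<in> borel_measurable L"
proof -
  define C :: "real ^ 'd ^ 'd" where "C = (SOME _. False)"
  have eq: "(matrix_inv (A x) *v b x) $ k
    = (if det (A x) = 0 then (C *v b x) $ k
       else det (\<chi> i j. if j = k then b x $ i else A x $ i $ j) / det (A x))" for x
  proof (cases "det (A x) = 0")
    case True
    then have "\<not> invertible (A x)" by (simp add: invertible_det_nz)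
    then have "matrix_inv (A x) = C"
      unfolding matrix_inv_def invertible_def C_def by (intro arg_cong[where f = Eps]) auto
    with True show ?thesis by simp
  next
    case False
    then have "invertible (A x)" by (simp add: invertible_det_nz)
    then have "A x *v (matrix_inv (A x) *v b x) = b x" by (rule matrix_inv_cancel)
    with False show ?thesis by (simp add: cramer)
  qed
  have [measurable]: "(\<lambda>x. det (A x)) \<in> borel_measurable L"
    "(\<lambda>x. det (\<chi> i j. if j = k then b x $ i else A x $ i $ j)) \<in> borel_measurable L"
    by (intro borel_measurable_det; simp)+
  show ?thesis unfolding eq unfolding matrix_vector_mult_def vec_lambda_beta by measurable
qed

lemma borel_measurable_leverage:
  fixes x :: "nat \<Rightarrow> 'b \<Rightarrow> real ^ 'd::finite"
  assumes "\<And>i j. (\<lambda>\<omega>. x i \<omega> $ j) \<in> borel_measurable L"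
    and "\<And>j. (\<lambda>\<omega>. a \<omega> $ j) \<in> borel_measurable L" "\<And>j. (\<lambda>\<omega>. b \<omega> $ j) \<in> borel_measurable L"
  shows "(\<lambda>\<omega>. leverage n (\<lambda>i. x i \<omega>) (a \<omega>) (b \<omega>)) \<in> borel_measurable L"
  unfolding leverage_def inner_vec_def using assms
  by (intro borel_measurable_sum borel_measurable_inner borel_measurable_matrix_inv_mult) (simp_all add: gram_def)

lemma borel_measurable_loo_residual:
  fixes x :: "nat \<Rightarrow> 'b \<Rightarrow> real ^ 'd::finite"
  assumes [measurable]: "\<And>i j. (\<lambda>\<omega>. x i \<omega> $ j) \<in> borel_measurable L" "\<And>i. y i \<in> borel_measurable L"
  shows "(\<lambda>\<omega>. loo_residual n (\<lambda>i. x i \<omega>) (\<lambda>i. y i \<omega>) i) \<in> borel_measurable L"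
proof -
  have [measurable]: "(\<lambda>\<omega>. leverage n (\<lambda>i. x i \<omega>) (x i \<omega>) (x i \<omega>)) \<in> borel_measurable L"
    by (intro borel_measurable_leverage) simp_all
  have [measurable]: "(\<lambda>\<omega>. ls_estimator n (\<lambda>i. x i \<omega>) (\<lambda>i. y i \<omega>) $ j) \<in> borel_measurable L" for j
    unfolding ls_estimator_def by (intro borel_measurable_matrix_inv_mult) (simp_all add: gram_def cross_def)
  show ?thesis unfolding loo_residual_def inner_vec_def by simp
qed

lemma borel_measurable_emp_quantile:
  fixes a :: "'b \<Rightarrow> nat \<Rightarrow> real"
  assumes [measurable]: "\<And>i. (\<lambda>x. a x i) \<in> borel_measurable L" and "0 < n" "0 < \<tau>" "\<tau> \<le> 1"
  shows "(\<lambda>x. emp_quantile \<tau> n (a x)) \<in> borel_measurable L"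
  unfolding borel_measurable_iff_le
proof
  fix c
  have "edf n (a x) c = (\<Sum>i<n. if a x i \<le> c then 1 else 0) / real n" for x
    by (simp add: edf_def sum.If_cases Int_def)
  then have [measurable]: "(\<lambda>x. edf n (a x) c) \<in> borel_measurable L" by simp
  show "{x \<in> space L. emp_quantile \<tau> n (a x) \<le> c} \<in> sets L"
    unfolding emp_quantile_le_iff[OF assms(2-4)] by measurable
qed

section \<open>Limits of the residual quantiles\<close>

context prob_space
begin

lemma iid_transfer_AE:
  assumes [measurable]: "\<And>i::nat. X i \<in> M \<rightarrow>\<^sub>M S" and id: "\<And>i. distr M S (X i) = distr M S (X 0)"
    and P [measurable]: "Measurable.pred S P" and AE: "AE \<omega> in M. P (X 0 \<omega>)"
  shows "AE \<omega> in M. \<forall>i. P (X i \<omega>)"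
proof -
  have "(AE p in distr M S (X k). P p) \<longleftrightarrow> (AE \<omega> in M. P (X k \<omega>))" for k
    by (rule AE_distr_iff) simp_all
  then have "AE \<omega> in M. P (X i \<omega>)" for i using AE id[of i] by metis
  then show ?thesis by (simp add: AE_all_countable)
qed

text \<open>
  A vector in the kernel of the second moment matrix is almost surely orthogonal to every observation
  and hence lies in the kernel of every Gram matrix. The almost sure invertibility of a single Gram
  matrix therefore carries over to the population.
\<close>

lemma invertible_second_moment_matrix:
  fixes Z :: "nat \<Rightarrow> 'a \<Rightarrow> real ^ 'd::finite"
  assumes [measurable]: "\<And>i. Z i \<in> borel_measurable M" and id: "\<And>i. distr M borel (Z i) = distr M borel (Z 0)"
    and mom: "\<And>j. fourth_moment (\<lambda>\<omega>. Z 0 \<omega> $ j)"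
    and inv: "\<forall>\<^sub>F n in sequentially. AE \<omega> in M. invertible (gram n (\<lambda>i. Z i \<omega>))"
  shows "invertible (\<chi> j k. expectation (\<lambda>\<omega>. Z 0 \<omega> $ j * Z 0 \<omega> $ k))" (is "invertible ?S")
proof (rule ccontr)
  assume "\<not> invertible ?S"
  then obtain a where a: "a \<noteq> 0" "?S *v a = 0"
    by (auto simp: invertible_left_inverse matrix_left_invertible_ker)
  have int: "integrable M (\<lambda>\<omega>. Z 0 \<omega> $ j * Z 0 \<omega> $ k)" for j k
    by (rule fourth_moment_product(2)[OF mom mom])
  have eq: "(\<lambda>\<omega>. (Z 0 \<omega> \<bullet> a)\<^sup>2) = (\<lambda>\<omega>. \<Sum>j\<in>UNIV. \<Sum>k\<in>UNIV. (a $ j * a $ k) * (Z 0 \<omega> $ j * Z 0 \<omega> $ k))"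
    by (simp add: inner_vec_def power2_eq_square sum_product mult_ac)
  have "expectation (\<lambda>\<omega>. (Z 0 \<omega> \<bullet> a)\<^sup>2) = a \<bullet> (?S *v a)"
    unfolding eq using int by (simp add: inner_vec_def matrix_vector_mult_def sum_distrib_left mult_ac)
  then have zero: "expectation (\<lambda>\<omega>. (Z 0 \<omega> \<bullet> a)\<^sup>2) = 0" by (simp add: a)
  have "integrable M (\<lambda>\<omega>. (Z 0 \<omega> \<bullet> a)\<^sup>2)" unfolding eq using int by simp
  with zero have "AE \<omega> in M. (Z 0 \<omega> \<bullet> a)\<^sup>2 = 0"
    by (subst (asm) integral_nonneg_eq_0_iff_AE) auto
  then have "AE \<omega> in M. Z 0 \<omega> \<bullet> a = 0" by simp
  then have "AE \<omega> in M. \<forall>i. Z i \<omega> \<bullet> a = 0"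
    by (intro iid_transfer_AE[where S = borel and X = Z and P = "\<lambda>z. z \<bullet> a = 0"] id) auto
  moreover obtain n where "AE \<omega> in M. invertible (gram n (\<lambda>i. Z i \<omega>))"
    using eventually_happens'[OF _ inv] by auto
  ultimately have "AE \<omega> in M. False"
  proof eventually_elim
    case (elim \<omega>)
    then have "gram n (\<lambda>i. Z i \<omega>) *v a = 0" by (simp add: gram_mult)
    then show False using elim(2) a(1) by (auto simp: invertible_left_inverse matrix_left_invertible_ker)
  qed
  then show False by simp
qed

text \<open>
  The hypotheses on the error are those shared by both regressions: it is normal with some mean, and
  its product with each regressor has mean 0, as is the case for the error of the reduced model. The
  weak law is applied to the entries of the Gram matrix, to the cross products of regressors and errors, to the squared errors
  and to the indicators that make up the empirical distribution function.
\<close>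

proposition tendsto_loo_quantile:
  fixes Z :: "nat \<Rightarrow> 'a \<Rightarrow> real ^ 'd::finite" and e y :: "nat \<Rightarrow> 'a \<Rightarrow> real"
  assumes indep: "indep_vars (\<lambda>_. borel \<Otimes>\<^sub>M borel) (\<lambda>i \<omega>. (Z i \<omega>, e i \<omega>)) UNIV"
    and id: "\<And>i. distr M (borel \<Otimes>\<^sub>M borel) (\<lambda>\<omega>. (Z i \<omega>, e i \<omega>)) = distr M (borel \<Otimes>\<^sub>M borel) (\<lambda>\<omega>. (Z 0 \<omega>, e 0 \<omega>))"
    and mom: "\<And>j. fourth_moment (\<lambda>\<omega>. Z 0 \<omega> $ j)"
    and orth: "\<And>j. expectation (\<lambda>\<omega>. Z 0 \<omega> $ j * e 0 \<omega>) = 0"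
    and inv: "\<forall>\<^sub>F n in sequentially. AE \<omega> in M. invertible (gram n (\<lambda>i. Z i \<omega>))"
    and normal: "distributed M lborel (e 0) (\<lambda>t. ennreal (normal_density m s t))" and s: "0 < s"
    and y: "\<And>i \<omega>. \<omega> \<in> space M \<Longrightarrow> y i \<omega> = Z i \<omega> \<bullet> b + e i \<omega>"
    and znew: "\<And>n \<omega>. znew n \<omega> = (1 / real n) *\<^sub>R (\<Sum>i<n. Z i \<omega>)"
    and \<tau>: "0 < \<tau>" "\<tau> < 1" and q: "cdf std_normal_distribution q = \<tau>"
  shows "((\<lambda>c. emp_quantile \<tau> (fst c) (\<lambda>i.
      (1 - leverage (fst c) (\<lambda>i. Z i (snd c)) (znew (fst c) (snd c)) (Z i (snd c)))
      * loo_residual (fst c) (\<lambda>i. Z i (snd c)) (\<lambda>i. y i (snd c)) i)) \<longlongrightarrow> m + s * q) high_prob"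
proof -
  have meas: "(\<lambda>\<omega>. (Z i \<omega>, e i \<omega>)) \<in> M \<rightarrow>\<^sub>M borel \<Otimes>\<^sub>M borel" for i
    using indep by (auto simp: indep_vars_def)
  have [measurable]: "Z i \<in> borel_measurable M" "e i \<in> borel_measurable M" for i
    using measurable_compose[OF meas measurable_fst] measurable_compose[OF meas measurable_snd] by simp_all
  have idZ: "distr M borel (Z i) = distr M borel (Z 0)" for i
  proof -
    have "distr M borel (Z k) = distr (distr M (borel \<Otimes>\<^sub>M borel) (\<lambda>\<omega>. (Z k \<omega>, e k \<omega>))) borel fst" for k
      by (subst distr_distr) (auto simp: comp_def)
    then show ?thesis using id[of i] by simp
  qed
  have "distr M borel (e 0) = density lborel (\<lambda>t. ennreal (normal_density m s t))"
    using distributed_distr_eq_density[OF normal] by (simp cong: distr_cong)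
  then have "normal_law (distr M borel (e 0))" using s unfolding normal_law_def by blast
  then have e4: "fourth_moment (e 0)" by (intro fourth_moment_normal) auto
  note avg = weak_law_iid[OF indep id, of "\<lambda>p. f (fst p) (snd p)" for f, simplified]
  show ?thesis
  proof (rule tendsto_emp_quantile)
    show "\<forall>\<^sub>F c in high_prob. 0 < fst c"
      using eventually_compose_filterlim[OF eventually_gt_at_top filterlim_fst_high_prob] .
    show "0 < \<tau>" "\<tau> \<le> 1" using \<tau> by auto
  next
    fix t
    have "integrable M (\<lambda>\<omega>. (indicator {..t} (e 0 \<omega>) :: real)\<^sup>2)"
      by (intro integrable_const_bound[of _ 1]) (auto split: split_indicator)
    then have "((\<lambda>c. (\<Sum>i<fst c. indicator {..t} (e i (snd c))) / real (fst c))
      \<longlongrightarrow> expectation (\<lambda>\<omega>. indicat_real {..t} (e 0 \<omega>))) high_prob"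
      by (intro avg[of "\<lambda>z v. indicator {..t} v"]) auto
    moreover have "expectation (\<lambda>\<omega>. indicat_real {..t} (e 0 \<omega>)) = prob {\<omega> \<in> space M. e 0 \<omega> \<le> t}"
    proof -
      have "expectation (\<lambda>\<omega>. indicat_real {..t} (e 0 \<omega>)) = expectation (indicator {\<omega> \<in> space M. e 0 \<omega> \<le> t})"
        by (intro Bochner_Integration.integral_cong) (auto split: split_indicator)
      then show ?thesis by simp
    qed
    moreover have "(\<Sum>i<n. indicator {..t} (e i \<omega>)) = real (card {i. i < n \<and> e i \<omega> \<le> t})" for n \<omega>
      by (simp add: indicator_def sum.If_cases Int_def)
    ultimately show "((\<lambda>c. edf (fst c) (\<lambda>i. e i (snd c)) t) \<longlongrightarrow> cdf std_normal_distribution ((t - m) / s)) high_prob"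
      by (simp add: edf_def prob_normal_le[OF normal s])
  next
    fix \<delta> :: real assume \<delta>: "0 < \<delta>"
    show "((\<lambda>c. far_fraction (fst c) (\<lambda>i.
      (1 - leverage (fst c) (\<lambda>i. Z i (snd c)) (znew (fst c) (snd c)) (Z i (snd c)))
      * loo_residual (fst c) (\<lambda>i. Z i (snd c)) (\<lambda>i. y i (snd c)) i) (\<lambda>i. e i (snd c)) \<delta>) \<longlongrightarrow> 0) high_prob"
    proof (rule far_fraction_loo_residuals[OF filterlim_fst_high_prob])
      show "((\<lambda>c. (1 / real (fst c)) *\<^sub>R gram (fst c) (\<lambda>i. Z i (snd c)))
        \<longlongrightarrow> (\<chi> j k. expectation (\<lambda>\<omega>. Z 0 \<omega> $ j * Z 0 \<omega> $ k))) high_prob"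
      proof (intro vec_tendstoI)
        fix j k
        have "((\<lambda>c. (\<Sum>i<fst c. Z i (snd c) $ j * Z i (snd c) $ k) / real (fst c))
          \<longlongrightarrow> expectation (\<lambda>\<omega>. Z 0 \<omega> $ j * Z 0 \<omega> $ k)) high_prob"
          using fourth_moment_product(1)[OF mom mom] by (intro avg[of "\<lambda>z v. z $ j * z $ k"]) auto
        then show "((\<lambda>c. ((1 / real (fst c)) *\<^sub>R gram (fst c) (\<lambda>i. Z i (snd c))) $ j $ k)
          \<longlongrightarrow> (\<chi> j k. expectation (\<lambda>\<omega>. Z 0 \<omega> $ j * Z 0 \<omega> $ k)) $ j $ k) high_prob"
          by (simp add: gram_def)
      qed
      show "invertible (\<chi> j k. expectation (\<lambda>\<omega>. Z 0 \<omega> $ j * Z 0 \<omega> $ k))"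
        by (rule invertible_second_moment_matrix[OF _ idZ mom inv]) simp
      show "((\<lambda>c. (1 / real (fst c)) *\<^sub>R cross (fst c) (\<lambda>i. Z i (snd c)) (\<lambda>i. e i (snd c))) \<longlongrightarrow> 0) high_prob"
      proof (intro vec_tendstoI)
        fix j
        have "((\<lambda>c. (\<Sum>i<fst c. Z i (snd c) $ j * e i (snd c)) / real (fst c))
          \<longlongrightarrow> expectation (\<lambda>\<omega>. Z 0 \<omega> $ j * e 0 \<omega>)) high_prob"
          using fourth_moment_product(1)[OF mom e4] by (intro avg[of "\<lambda>z v. z $ j * v"]) auto
        then show "((\<lambda>c. ((1 / real (fst c)) *\<^sub>R cross (fst c) (\<lambda>i. Z i (snd c)) (\<lambda>i. e i (snd c))) $ j)
          \<longlongrightarrow> 0 $ j) high_prob"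
          by (simp add: cross_def orth)
      qed
      show "((\<lambda>c. (\<Sum>i<fst c. (e i (snd c))\<^sup>2) / real (fst c)) \<longlongrightarrow> expectation (\<lambda>\<omega>. (e 0 \<omega>)\<^sup>2)) high_prob"
        using fourth_moment_product(1)[OF e4 e4]
        by (intro avg[of "\<lambda>z v. v\<^sup>2"]) (auto simp: power2_eq_square)
      show "\<forall>\<^sub>F c in high_prob. \<forall>i. y i (snd c) = Z i (snd c) \<bullet> b + e i (snd c)"
        using eventually_snd_in_space by eventually_elim (simp add: y)
    qed (use znew \<delta> in auto)
  next
    fix \<epsilon> :: real assume "0 < \<epsilon>"
    then show "cdf std_normal_distribution ((m + s * q - \<epsilon> - m) / s) < \<tau>"
      "\<tau> < cdf std_normal_distribution ((m + s * q + \<epsilon> - m) / s)"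
      unfolding q[symmetric] using s by (auto intro!: cdf_std_normal_strict_mono simp: field_simps)
  qed
qed

end

section \<open>The error of the model with omitted covariates\<close>

text \<open>
  If \<open>c \<bullet> w\<close> is an affine function of \<open>z\<close>, then it equals its own conditional expectation, so the
  combination \<open>\<Sum>k. c k * r k\<close> of the residuals \<open>r k = w k - E[w k | z]\<close> vanishes. By linearity the
  conditional covariance matrix then maps \<open>c\<close> to 0. Each product of residuals must be known to be
  integrable, which follows from Jensen's inequality for the conditional expectation.
\<close>

lemma (in prob_space) cond_var_affine:
  fixes w :: "'a \<Rightarrow> real ^ 'r::finite" and z :: "'a \<Rightarrow> real ^ 'q::finite"
  assumes w [measurable]: "w \<in> borel_measurable M" and z [measurable]: "z \<in> borel_measurable M"
    and sq: "\<And>j. integrable M (\<lambda>\<omega>. (w \<omega> $ j)\<^sup>2)"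
    and affine: "AE \<omega> in M. c \<bullet> w \<omega> = m + a \<bullet> z \<omega>"
  shows "AE \<omega> in M. c \<bullet> (cond_var M w z \<omega> *v c) = 0"
proof -
  define F where "F = vimage_algebra (space M) z borel"
  have "subalgebra M F"
    unfolding subalgebra_def F_def using measurable_sets[OF z] by (auto simp: sets_vimage_algebra2)
  then interpret finite_measure_subalgebra M F by unfold_locales
  have zF: "z \<in> F \<rightarrow>\<^sub>M borel" unfolding F_def by (rule measurable_vimage_algebra1) simp
  define r where "r j \<omega> = w \<omega> $ j - real_cond_exp M F (\<lambda>\<omega>. w \<omega> $ j) \<omega>" for j \<omega>
  have int: "integrable M (\<lambda>\<omega>. w \<omega> $ j)" for j
    by (rule square_integrable_imp_integrable[OF _ sq]) simp
  have [measurable]: "r j \<in> borel_measurable M" for j unfolding r_def[abs_def] by simp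
  have rsq: "integrable M (\<lambda>\<omega>. (r j \<omega>)\<^sup>2)" for j
  proof -
    have "integrable M (\<lambda>\<omega>. (real_cond_exp M F (\<lambda>\<omega>. w \<omega> $ j) \<omega>)\<^sup>2)"
      by (rule integrable_convex_cond_exp[where I = UNIV and q = power2]) (auto simp: int sq convex_power2)
    then have "integrable M (\<lambda>\<omega>. 2 * ((w \<omega> $ j)\<^sup>2 + (real_cond_exp M F (\<lambda>\<omega>. w \<omega> $ j) \<omega>)\<^sup>2))"
      using sq by simp
    then show ?thesis
    proof (rule Bochner_Integration.integrable_bound)
      have "(u - v)\<^sup>2 \<le> 2 * (u\<^sup>2 + v\<^sup>2)" for u v :: real
        using sum_squares_bound[of u "- v"] by (simp add: power2_diff)
      then show "AE \<omega> in M. norm ((r j \<omega>)\<^sup>2)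
        \<le> norm (2 * ((w \<omega> $ j)\<^sup>2 + (real_cond_exp M F (\<lambda>\<omega>. w \<omega> $ j) \<omega>)\<^sup>2))"
        unfolding r_def by simp
    qed simp
  qed
  have rr: "integrable M (\<lambda>\<omega>. r j \<omega> * r k \<omega>)" for j k
  proof (rule Bochner_Integration.integrable_bound)
    show "integrable M (\<lambda>\<omega>. (r j \<omega>)\<^sup>2 + (r k \<omega>)\<^sup>2)" using rsq by simp
    have "\<bar>u * v\<bar> \<le> u\<^sup>2 + v\<^sup>2" for u v :: real
    proof -
      have "2 * (\<bar>u\<bar> * \<bar>v\<bar>) \<le> u\<^sup>2 + v\<^sup>2" using sum_squares_bound[of "\<bar>u\<bar>" "\<bar>v\<bar>"] by simp
      moreover have "0 \<le> \<bar>u\<bar> * \<bar>v\<bar>" by simp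
      ultimately show ?thesis unfolding abs_mult by linarith
    qed
    then show "AE \<omega> in M. norm (r j \<omega> * r k \<omega>) \<le> norm ((r j \<omega>)\<^sup>2 + (r k \<omega>)\<^sup>2)" by simp
  qed simp
  have cw: "integrable M (\<lambda>\<omega>. \<Sum>j\<in>UNIV. c $ j * w \<omega> $ j)" using int by simp
  have gF: "(\<lambda>\<omega>. m + a \<bullet> z \<omega>) \<in> borel_measurable F" using zF by measurable
  have g: "(\<lambda>\<omega>. m + a \<bullet> z \<omega>) \<in> borel_measurable M" by measurable
  have ae: "AE \<omega> in M. (\<Sum>j\<in>UNIV. c $ j * w \<omega> $ j) = m + a \<bullet> z \<omega>"
    using affine by (simp add: inner_vec_def)
  have gint: "integrable M (\<lambda>\<omega>. m + a \<bullet> z \<omega>)" using integrable_cong_AE_imp[OF cw g] ae by (auto elim: AE_mp)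
  have "AE \<omega> in M. real_cond_exp M F (\<lambda>\<omega>. \<Sum>j\<in>UNIV. c $ j * w \<omega> $ j) \<omega> = real_cond_exp M F (\<lambda>\<omega>. m + a \<bullet> z \<omega>) \<omega>"
    by (rule real_cond_exp_cong[OF ae _ g]) simp
  moreover have "AE \<omega> in M. real_cond_exp M F (\<lambda>\<omega>. m + a \<bullet> z \<omega>) \<omega> = m + a \<bullet> z \<omega>"
    by (rule real_cond_exp_F_meas[OF gint gF])
  moreover have "AE \<omega> in M. real_cond_exp M F (\<lambda>\<omega>. \<Sum>j\<in>UNIV. c $ j * w \<omega> $ j) \<omega>
      = (\<Sum>j\<in>UNIV. real_cond_exp M F (\<lambda>\<omega>. c $ j * w \<omega> $ j) \<omega>)"
    by (rule real_cond_exp_sum) (simp add: int)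
  moreover have "AE \<omega> in M. \<forall>j\<in>UNIV. real_cond_exp M F (\<lambda>\<omega>. c $ j * w \<omega> $ j) \<omega> = c $ j * real_cond_exp M F (\<lambda>\<omega>. w \<omega> $ j) \<omega>"
    by (intro AE_finite_allI finite real_cond_exp_cmult int)
  ultimately have cr: "AE \<omega> in M. (\<Sum>k\<in>UNIV. c $ k * r k \<omega>) = 0"
    using ae by eventually_elim (simp add: r_def right_diff_distrib sum_subtractf)
  have row: "AE \<omega> in M. (\<Sum>k\<in>UNIV. c $ k * real_cond_exp M F (\<lambda>\<omega>. r j \<omega> * r k \<omega>) \<omega>) = 0" for j
  proof -
    have "AE \<omega> in M. real_cond_exp M F (\<lambda>\<omega>. \<Sum>k\<in>UNIV. c $ k * (r j \<omega> * r k \<omega>)) \<omega> = real_cond_exp M F (\<lambda>_. 0) \<omega>"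
    proof (rule real_cond_exp_cong)
      show "AE \<omega> in M. (\<Sum>k\<in>UNIV. c $ k * (r j \<omega> * r k \<omega>)) = 0"
        using cr
      proof eventually_elim
        case (elim \<omega>)
        have "(\<Sum>k\<in>UNIV. c $ k * (r j \<omega> * r k \<omega>)) = r j \<omega> * (\<Sum>k\<in>UNIV. c $ k * r k \<omega>)"
          by (simp add: sum_distrib_left mult_ac)
        then show ?case using elim by simp
      qed
    qed simp_all
    moreover have "AE \<omega> in M. real_cond_exp M F (\<lambda>_. 0) \<omega> = 0" by (rule real_cond_exp_F_meas) simp_all
    moreover have "AE \<omega> in M. real_cond_exp M F (\<lambda>\<omega>. \<Sum>k\<in>UNIV. c $ k * (r j \<omega> * r k \<omega>)) \<omega>
        = (\<Sum>k\<in>UNIV. real_cond_exp M F (\<lambda>\<omega>. c $ k * (r j \<omega> * r k \<omega>)) \<omega>)"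
      by (rule real_cond_exp_sum) (simp add: rr)
    moreover have "AE \<omega> in M. \<forall>k\<in>UNIV. real_cond_exp M F (\<lambda>\<omega>. c $ k * (r j \<omega> * r k \<omega>)) \<omega>
        = c $ k * real_cond_exp M F (\<lambda>\<omega>. r j \<omega> * r k \<omega>) \<omega>"
      by (intro AE_finite_allI finite real_cond_exp_cmult rr)
    ultimately show ?thesis by eventually_elim simp
  qed
  have "AE \<omega> in M. \<forall>j\<in>UNIV. (\<Sum>k\<in>UNIV. c $ k * real_cond_exp M F (\<lambda>\<omega>. r j \<omega> * r k \<omega>) \<omega>) = 0"
    by (intro AE_finite_allI finite row)
  then show ?thesis
  proof eventually_elim
    case (elim \<omega>)
    have "(cond_var M w z \<omega> *v c) $ j = (\<Sum>k\<in>UNIV. c $ k * real_cond_exp M F (\<lambda>\<omega>. r j \<omega> * r k \<omega>) \<omega>)" for j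
      by (simp add: cond_var_def Let_def matrix_vector_mult_def F_def[symmetric] r_def[symmetric] mult.commute)
    then show ?case using elim by (simp add: inner_vec_def)
  qed
qed

lemma inner_first_last:
  "x \<bullet> b = first_part x \<bullet> first_part b + last_part x \<bullet> last_part b"
proof -
  have "x \<bullet> b = (\<Sum>k\<in>UNIV <+> UNIV. x $ k * b $ k)" by (simp add: inner_vec_def)
  also have "\<dots> = (\<Sum>j\<in>UNIV. x $ Inl j * b $ Inl j) + (\<Sum>j\<in>UNIV. x $ Inr j * b $ Inr j)"
    by (subst sum.Plus) simp_all
  finally show ?thesis by (simp add: inner_vec_def first_part_def last_part_def)
qed

text \<open>
  A linear function \<open>x \<bullet> b\<close> of a normal vector is either constant or properly normal. The first
  case contradicts the positive conditional variance, and in the second one the variance of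
  \<open>x \<bullet> b\<close> is added to that of \<open>\<epsilon>\<close>. This
  is applied to a \<open>b\<close> that differs from the true coefficients only on the included covariates.
\<close>

lemma (in prob_space) omitted_covariates_error_normal:
  fixes x :: "'a \<Rightarrow> real ^ ('q::finite + 'r::finite)"
  assumes x [measurable]: "x \<in> borel_measurable M" and N: "mv_normal_law (distr M borel x)"
    and indep: "indep_var borel \<epsilon> borel (\<lambda>\<omega>. x \<omega> \<bullet> b)"
    and \<epsilon>: "distributed M lborel \<epsilon> (\<lambda>t. ennreal (normal_density 0 \<sigma> t))" and \<sigma>: "0 < \<sigma>"
    and pos: "AE \<omega> in M. last_part b \<bullet>
      (cond_var M (\<lambda>\<omega>. last_part (x \<omega>)) (\<lambda>\<omega>. first_part (x \<omega>)) \<omega> *v last_part b) > 0"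
  obtains m s where "\<sigma> < s" "distributed M lborel (\<lambda>\<omega>. \<epsilon> \<omega> + x \<omega> \<bullet> b) (\<lambda>t. ennreal (normal_density m s t))"
proof -
  have proj: "normal_law (distr M borel (\<lambda>\<omega>. x \<omega> \<bullet> a))" for a
  proof -
    have "normal_law (distr (distr M borel x) borel (\<lambda>v. a \<bullet> v))"
      using N by (simp add: mv_normal_law_def)
    then show ?thesis by (simp add: distr_distr comp_def inner_commute)
  qed
  have comp4: "fourth_moment (\<lambda>\<omega>. x \<omega> $ k)" for k
    using proj[of "axis k 1"] by (intro fourth_moment_normal) (simp_all add: inner_axis)
  from proj[of b] consider m where "distr M borel (\<lambda>\<omega>. x \<omega> \<bullet> b) = return borel m"
    | m t where "0 < t" "distr M borel (\<lambda>\<omega>. x \<omega> \<bullet> b) = density lborel (\<lambda>v. ennreal (normal_density m t v))"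
    unfolding normal_law_def by blast
  then show ?thesis
  proof cases
    case 1
    have "AE v in distr M borel (\<lambda>\<omega>. x \<omega> \<bullet> b). v = m" unfolding 1 by (simp add: AE_return)
    then have "AE \<omega> in M. x \<omega> \<bullet> b = m" by (subst (asm) AE_distr_iff) auto
    then have "AE \<omega> in M. last_part b \<bullet> last_part (x \<omega>) = m + (- first_part b) \<bullet> first_part (x \<omega>)"
      by eventually_elim (simp add: inner_first_last[of _ b] inner_commute[of "last_part b"] inner_commute[of "first_part b"])
    then have "AE \<omega> in M. last_part b \<bullet>
      (cond_var M (\<lambda>\<omega>. last_part (x \<omega>)) (\<lambda>\<omega>. first_part (x \<omega>)) \<omega> *v last_part b) = 0"
    proof (rule cond_var_affine[rotated 3])
      show "integrable M (\<lambda>\<omega>. (last_part (x \<omega>) $ j)\<^sup>2)" for j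
        using fourth_moment_integrable(2)[OF comp4] by (simp add: last_part_def)
    qed (auto intro!: borel_measurable_vecI simp: last_part_def first_part_def)
    with pos have "AE \<omega> in M. False" by eventually_elim simp
    then show ?thesis by simp
  next
    case 2
    have "distributed M lborel (\<lambda>\<omega>. x \<omega> \<bullet> b) (\<lambda>v. ennreal (normal_density m t v))"
      unfolding distributed_def using 2(2) by (simp cong: distr_cong)
    then have "distributed M lborel (\<lambda>\<omega>. \<epsilon> \<omega> + x \<omega> \<bullet> b) (normal_density (0 + m) (sqrt (\<sigma>\<^sup>2 + t\<^sup>2)))"
      using 2(1) \<sigma> \<epsilon> indep by (intro add_indep_normal)
    moreover have "\<sigma> < sqrt (\<sigma>\<^sup>2 + t\<^sup>2)" using 2(1) by (intro real_less_rsqrt) simp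
    ultimately show ?thesis using that by simp
  qed
qed

section \<open>Comparison of the two widths\<close>

theorem proposition2:
  fixes M :: "'a measure"
    and x :: "nat \<Rightarrow> 'a \<Rightarrow> real ^ ('q::finite + 'r::finite)"
    and eps y :: "nat \<Rightarrow> 'a \<Rightarrow> real"
    and \<beta> :: "real ^ ('q + 'r)"
    and \<alpha> \<sigma> :: real
    and N :: "(real ^ ('q + 'r)) measure"
  defines "z \<equiv> \<lambda>i \<omega>. first_part (x i \<omega>)"
    and "w \<equiv> \<lambda>i \<omega>. last_part (x i \<omega>)"
    and "xnew \<equiv> \<lambda>n \<omega>. (1 / real n) *\<^sub>R (\<Sum>i<n. x i \<omega>)"
  defines "u \<equiv> \<lambda>n \<omega>. loo_residual n (\<lambda>i. x i \<omega>) (\<lambda>i. y i \<omega>)"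
    and "v \<equiv> \<lambda>n \<omega>. loo_residual n (\<lambda>i. z i \<omega>) (\<lambda>i. y i \<omega>)"
    and "h_new \<equiv> \<lambda>n \<omega> i. leverage n (\<lambda>i. x i \<omega>) (xnew n \<omega>) (x i \<omega>)"
    and "g_new \<equiv> \<lambda>n \<omega> i. leverage n (\<lambda>i. z i \<omega>) (first_part (xnew n \<omega>)) (z i \<omega>)"
  assumes "prob_space M"
    and "0 < \<alpha>" "\<alpha> < 1"
    and "0 < \<sigma>"
    and "\<And>i \<omega>. \<omega> \<in> space M \<Longrightarrow> y i \<omega> = x i \<omega> \<bullet> \<beta> + eps i \<omega>"
    and "prob_space.indep_vars M (\<lambda>_. borel) eps UNIV"
    and "\<And>i. distributed M lborel (eps i) (\<lambda>t. ennreal (normal_density 0 \<sigma> t))"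
    and "prob_space.indep_vars M (\<lambda>_. borel) x UNIV"
    and "\<And>i. distr M borel (x i) = N"
    and "mv_normal_law N"
    and "prob_space.indep_set M
      (sets (vimage_algebra (space M) (\<lambda>\<omega> i. eps i \<omega>) (PiM UNIV (\<lambda>_. borel))))
      (sets (vimage_algebra (space M) (\<lambda>\<omega> i. x i \<omega>) (PiM UNIV (\<lambda>_. borel))))"
    and "\<forall>\<^sub>F n in sequentially. AE \<omega> in M.
      invertible (gram n (\<lambda>i. x i \<omega>)) \<and> invertible (gram n (\<lambda>i. z i \<omega>))"
    and "AE \<omega> in M. last_part \<beta> \<bullet> (cond_var M (w 0) (z 0) \<omega> *v last_part \<beta>) > 0"
  shows "(\<lambda>n. measure M {\<omega> \<in> space M.
      emp_quantile (1 - \<alpha> / 2) n (\<lambda>i. (1 - g_new n \<omega> i) * v n \<omega> i)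
      - emp_quantile (\<alpha> / 2) n (\<lambda>i. (1 - g_new n \<omega> i) * v n \<omega> i)
      > emp_quantile (1 - \<alpha> / 2) n (\<lambda>i. (1 - h_new n \<omega> i) * u n \<omega> i)
      - emp_quantile (\<alpha> / 2) n (\<lambda>i. (1 - h_new n \<omega> i) * u n \<omega> i)})
    \<longlonglongrightarrow> 1"
proof -
  interpret prob_space M by fact
  note \<alpha> = \<open>0 < \<alpha>\<close> \<open>\<alpha> < 1\<close> and y = assms(12) and eps_ind = assms(13) and eps_normal = assms(14)
    and x_ind = assms(15) and x_dist = assms(16) and N = assms(17) and eps_x = assms(18)
    and inv = assms(19) and cv = assms(20)
  have x_meas [measurable]: "x i \<in> borel_measurable M" and eps_meas [measurable]: "eps i \<in> borel_measurable M" for i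
    using x_ind eps_ind by (auto simp: indep_vars_def)
  have pair_ind: "indep_vars (\<lambda>_. borel \<Otimes>\<^sub>M borel) (\<lambda>i \<omega>. (eps i \<omega>, x i \<omega>)) UNIV"
    by (rule indep_vars_Pair[OF eps_ind x_ind eps_x])
  have eps_g_x: "indep_var borel (eps 0) borel (\<lambda>\<omega>. g (x 0 \<omega>))"
    if "g \<in> borel_measurable borel" for g :: "real ^ ('q + 'r) \<Rightarrow> real"
    using indep_var_of_indep_sequences[OF eps_meas x_meas eps_x measurable_ident that] by simp
  have eps_dist: "distr M borel (eps i) = density lborel (\<lambda>t. ennreal (normal_density 0 \<sigma> t))" for i
    using distributed_distr_eq_density[OF eps_normal[of i]] by (simp cong: distr_cong)
  have pair_id: "distr M (borel \<Otimes>\<^sub>M borel) (\<lambda>\<omega>. (eps i \<omega>, x i \<omega>))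
      = distr M (borel \<Otimes>\<^sub>M borel) (\<lambda>\<omega>. (eps 0 \<omega>, x 0 \<omega>))" for i
  proof -
    have "distr M (borel \<Otimes>\<^sub>M borel) (\<lambda>\<omega>. (eps k \<omega>, x k \<omega>)) = distr M borel (eps k) \<Otimes>\<^sub>M distr M borel (x k)" for k
      by (rule distr_Pair_of_indep_sequences[OF eps_meas x_meas eps_x])
    then show ?thesis unfolding eps_dist x_dist by simp
  qed
  have x4: "fourth_moment (\<lambda>\<omega>. x 0 \<omega> $ k)" for k
  proof -
    have "normal_law (distr N borel (\<lambda>v. axis k 1 \<bullet> v))" using N unfolding mv_normal_law_def by blast
    then have "normal_law (distr M borel (\<lambda>\<omega>. x 0 \<omega> $ k))"
      unfolding x_dist[of 0, symmetric] by (simp add: distr_distr comp_def inner_axis')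
    then show ?thesis by (intro fourth_moment_normal) simp_all
  qed
  have eps4: "fourth_moment (eps 0)"
    using \<open>0 < \<sigma>\<close> eps_dist[of 0] by (intro fourth_moment_normal) (auto simp: normal_law_def)
  have z4: "fourth_moment (\<lambda>\<omega>. z 0 \<omega> $ j)" for j
    using x4[of "Inl j"] by (simp add: z_def first_part_def)
  have inv_x: "\<forall>\<^sub>F n in sequentially. AE \<omega> in M. invertible (gram n (\<lambda>i. x i \<omega>))"
    and inv_z: "\<forall>\<^sub>F n in sequentially. AE \<omega> in M. invertible (gram n (\<lambda>i. z i \<omega>))"
    using inv by (auto elim!: eventually_mono)
  have z_meas [measurable]: "z i \<in> borel_measurable M" for i
    by (rule borel_measurable_vecI) (simp add: z_def first_part_def)
  have first_meas [measurable]: "first_part \<in> borel_measurable (borel :: (real ^ ('q + 'r)) measure)"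
    by (rule borel_measurable_vecI) (simp add: first_part_def)

  \<comment> \<open>\<open>\<gamma>\<close> is the population least squares coefficient of \<open>y\<close> on \<open>z\<close>. Subtracting \<open>z \<bullet> \<gamma>\<close> from \<open>x \<bullet> \<beta>\<close>
    leaves \<open>x \<bullet> b\<close>, and \<open>b\<close> agrees with \<open>\<beta>\<close> on the omitted covariates.\<close>
  define S where "S = (\<chi> j k. expectation (\<lambda>\<omega>. z 0 \<omega> $ j * z 0 \<omega> $ k))"
  define c where "c = (\<chi> j. expectation (\<lambda>\<omega>. z 0 \<omega> $ j * (x 0 \<omega> \<bullet> \<beta> + eps 0 \<omega>)))"
  define \<gamma> where "\<gamma> = matrix_inv S *v c"
  have "distr M borel (z i) = distr M borel (z 0)" for i
    using iid_compose(2)[OF x_ind, of first_part borel i] x_dist unfolding z_def by simp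
  then have S: "invertible S"
    unfolding S_def by (intro invertible_second_moment_matrix z4 inv_z) simp_all
  define b :: "real ^ ('q + 'r)" where "b = (\<chi> k. case k of Inl j \<Rightarrow> \<beta> $ Inl j - \<gamma> $ j | Inr j \<Rightarrow> \<beta> $ Inr j)"
  have b: "first_part b = first_part \<beta> - \<gamma>" "last_part b = last_part \<beta>"
    by (simp_all add: b_def first_part_def last_part_def vec_eq_iff)
  define e where "e i \<omega> = eps i \<omega> + x i \<omega> \<bullet> b" for i \<omega>
  have e: "e i \<omega> = x i \<omega> \<bullet> \<beta> + eps i \<omega> - z i \<omega> \<bullet> \<gamma>" for i \<omega>
    unfolding e_def by (simp add: inner_first_last[of "x i \<omega>"] b z_def inner_diff_right)
  obtain m s where s: "\<sigma> < s" and e_normal: "distributed M lborel (e 0) (\<lambda>t. ennreal (normal_density m s t))"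
  proof (rule omitted_covariates_error_normal[OF x_meas[of 0] _ eps_g_x eps_normal \<open>0 < \<sigma>\<close>, where b = b])
    show "mv_normal_law (distr M borel (x 0))" using N x_dist by simp
    show "AE \<omega> in M. last_part b \<bullet>
      (cond_var M (\<lambda>\<omega>. last_part (x 0 \<omega>)) (\<lambda>\<omega>. first_part (x 0 \<omega>)) \<omega> *v last_part b) > 0"
      using cv by (simp add: b w_def z_def)
  qed (simp_all add: e_def[abs_def] that)
  have zz: "integrable M (\<lambda>\<omega>. z 0 \<omega> $ j * z 0 \<omega> $ k)" for j k
    by (rule fourth_moment_product(2)[OF z4 z4])
  have zy: "integrable M (\<lambda>\<omega>. z 0 \<omega> $ j * (x 0 \<omega> \<bullet> \<beta> + eps 0 \<omega>))" for j
  proof -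
    have "integrable M (\<lambda>\<omega>. (\<Sum>k\<in>UNIV. \<beta> $ k * (z 0 \<omega> $ j * x 0 \<omega> $ k)) + z 0 \<omega> $ j * eps 0 \<omega>)"
      using fourth_moment_product(2)[OF z4 x4] fourth_moment_product(2)[OF z4 eps4] by simp
    then show ?thesis by (simp add: inner_vec_def distrib_left sum_distrib_left mult_ac)
  qed
  \<comment> \<open>These are the normal equations that define \<open>\<gamma>\<close>.\<close>
  have orth_z: "expectation (\<lambda>\<omega>. z 0 \<omega> $ j * e 0 \<omega>) = 0" for j
  proof -
    have "expectation (\<lambda>\<omega>. z 0 \<omega> $ j * e 0 \<omega>)
      = expectation (\<lambda>\<omega>. z 0 \<omega> $ j * (x 0 \<omega> \<bullet> \<beta> + eps 0 \<omega>) - (\<Sum>k\<in>UNIV. \<gamma> $ k * (z 0 \<omega> $ j * z 0 \<omega> $ k)))"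
      by (simp add: e inner_vec_def[of "z 0 _"] right_diff_distrib sum_distrib_left mult_ac)
    also have "\<dots> = c $ j - (S *v \<gamma>) $ j"
      using zy zz by (simp add: c_def S_def matrix_vector_mult_def mult.commute)
    also have "\<dots> = 0" unfolding \<gamma>_def matrix_inv_cancel[OF S] by simp
    finally show ?thesis .
  qed
  have orth_x: "expectation (\<lambda>\<omega>. x 0 \<omega> $ k * eps 0 \<omega>) = 0" for k
  proof -
    have "indep_var borel (eps 0) borel (\<lambda>\<omega>. x 0 \<omega> $ k)"
      by (rule eps_g_x) simp
    then have "expectation (\<lambda>\<omega>. eps 0 \<omega> * x 0 \<omega> $ k) = expectation (eps 0) * expectation (\<lambda>\<omega>. x 0 \<omega> $ k)"
      using fourth_moment_integrable(1)[OF eps4] fourth_moment_integrable(1)[OF x4]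
      by (intro indep_var_lebesgue_integral)
    also have "expectation (eps 0) = 0"
      using normal_distributed_expectation[OF \<open>0 < \<sigma>\<close> eps_normal[of 0]] .
    finally show ?thesis by (simp add: mult.commute)
  qed

  have lim_x: "((\<lambda>c. emp_quantile \<tau> (fst c) (\<lambda>i. (1 - h_new (fst c) (snd c) i) * u (fst c) (snd c) i)) \<longlongrightarrow> 0 + \<sigma> * q) high_prob"
    if "0 < \<tau>" "\<tau> < 1" "cdf std_normal_distribution q = \<tau>" for \<tau> q
    unfolding h_new_def u_def
  proof (rule tendsto_loo_quantile[where e = eps and b = \<beta>])
    show "indep_vars (\<lambda>_. borel \<Otimes>\<^sub>M borel) (\<lambda>i \<omega>. (x i \<omega>, eps i \<omega>)) UNIV"
      using iid_compose(1)[OF pair_ind pair_id, of "\<lambda>p. (snd p, fst p)" "borel \<Otimes>\<^sub>M borel"] by simp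
    show "distr M (borel \<Otimes>\<^sub>M borel) (\<lambda>\<omega>. (x i \<omega>, eps i \<omega>)) = distr M (borel \<Otimes>\<^sub>M borel) (\<lambda>\<omega>. (x 0 \<omega>, eps 0 \<omega>))" for i
      using iid_compose(2)[OF pair_ind pair_id, of "\<lambda>p. (snd p, fst p)" "borel \<Otimes>\<^sub>M borel" i] by simp
  qed (use x4 orth_x inv_x eps_normal \<open>0 < \<sigma>\<close> y that in \<open>simp_all add: xnew_def\<close>)
  have lim_z: "((\<lambda>c. emp_quantile \<tau> (fst c) (\<lambda>i. (1 - g_new (fst c) (snd c) i) * v (fst c) (snd c) i)) \<longlongrightarrow> m + s * q) high_prob"
    if "0 < \<tau>" "\<tau> < 1" "cdf std_normal_distribution q = \<tau>" for \<tau> q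
    unfolding g_new_def v_def
  proof (rule tendsto_loo_quantile[where e = e and b = \<gamma>])
    show "indep_vars (\<lambda>_. borel \<Otimes>\<^sub>M borel) (\<lambda>i \<omega>. (z i \<omega>, e i \<omega>)) UNIV"
      using iid_compose(1)[OF pair_ind pair_id, of "\<lambda>p. (first_part (snd p), fst p + snd p \<bullet> b)" "borel \<Otimes>\<^sub>M borel"]
      by (simp add: z_def e_def[abs_def])
    show "distr M (borel \<Otimes>\<^sub>M borel) (\<lambda>\<omega>. (z i \<omega>, e i \<omega>)) = distr M (borel \<Otimes>\<^sub>M borel) (\<lambda>\<omega>. (z 0 \<omega>, e 0 \<omega>))" for i
      using iid_compose(2)[OF pair_ind pair_id, of "\<lambda>p. (first_part (snd p), fst p + snd p \<bullet> b)" "borel \<Otimes>\<^sub>M borel" i]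
      by (simp add: z_def e_def[abs_def])
    show "first_part (xnew n \<omega>) = (1 / real n) *\<^sub>R (\<Sum>i<n. z i \<omega>)" for n \<omega>
      by (simp add: xnew_def z_def first_part_def vec_eq_iff)
    show "y i \<omega> = z i \<omega> \<bullet> \<gamma> + e i \<omega>" if "\<omega> \<in> space M" for i \<omega> using y[OF that] by (simp add: e)
  qed (use z4 orth_z inv_z e_normal \<open>0 < \<sigma>\<close> s that in \<open>simp_all\<close>)

  obtain q1 where q1: "cdf std_normal_distribution q1 = 1 - \<alpha> / 2"
    using std_normal_quantile_exists[of "1 - \<alpha> / 2"] \<alpha> by auto
  obtain q2 where q2: "cdf std_normal_distribution q2 = \<alpha> / 2"
    using std_normal_quantile_exists[of "\<alpha> / 2"] \<alpha> by auto
  have "q2 < q1"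
  proof (rule ccontr)
    assume "\<not> q2 < q1"
    then show False
      using cdf_std_normal_strict_mono[of q1 q2] q1 q2 \<alpha> by (cases "q1 = q2") auto
  qed
  \<comment> \<open>The mean \<open>m\<close> of the error of the reduced model cancels in the difference of quantiles.\<close>
  then have gap: "0 < (m + s * q1 - (m + s * q2)) - (0 + \<sigma> * q1 - (0 + \<sigma> * q2))"
    using s mult_strict_right_mono[of \<sigma> s "q1 - q2"] by (simp add: algebra_simps)
  have tau: "0 < 1 - \<alpha> / 2" "1 - \<alpha> / 2 < 1" "0 < \<alpha> / 2" "\<alpha> / 2 < 1" using \<alpha> by auto
  have "\<forall>\<^sub>F c in high_prob. 0 <
      (emp_quantile (1 - \<alpha> / 2) (fst c) (\<lambda>i. (1 - g_new (fst c) (snd c) i) * v (fst c) (snd c) i)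
      - emp_quantile (\<alpha> / 2) (fst c) (\<lambda>i. (1 - g_new (fst c) (snd c) i) * v (fst c) (snd c) i))
      - (emp_quantile (1 - \<alpha> / 2) (fst c) (\<lambda>i. (1 - h_new (fst c) (snd c) i) * u (fst c) (snd c) i)
      - emp_quantile (\<alpha> / 2) (fst c) (\<lambda>i. (1 - h_new (fst c) (snd c) i) * u (fst c) (snd c) i))"
    by (intro order_tendstoD(1)[OF _ gap] tendsto_diff lim_z lim_x tau q1 q2)
  then have "\<forall>\<^sub>F c in high_prob.
      emp_quantile (1 - \<alpha> / 2) (fst c) (\<lambda>i. (1 - h_new (fst c) (snd c) i) * u (fst c) (snd c) i)
      - emp_quantile (\<alpha> / 2) (fst c) (\<lambda>i. (1 - h_new (fst c) (snd c) i) * u (fst c) (snd c) i)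
      < emp_quantile (1 - \<alpha> / 2) (fst c) (\<lambda>i. (1 - g_new (fst c) (snd c) i) * v (fst c) (snd c) i)
      - emp_quantile (\<alpha> / 2) (fst c) (\<lambda>i. (1 - g_new (fst c) (snd c) i) * v (fst c) (snd c) i)"
    by simp
  then show ?thesis
  proof (rule tendsto_prob_one)
    have [measurable]: "y i \<in> borel_measurable M" for i
      by (subst measurable_cong[OF y]) simp_all
    have [measurable]: "(\<lambda>\<omega>. h_new n \<omega> i) \<in> borel_measurable M" "(\<lambda>\<omega>. g_new n \<omega> i) \<in> borel_measurable M"
      "(\<lambda>\<omega>. u n \<omega> i) \<in> borel_measurable M" "(\<lambda>\<omega>. v n \<omega> i) \<in> borel_measurable M" for n i
      unfolding h_new_def g_new_def u_def v_def
      by (intro borel_measurable_leverage borel_measurable_loo_residual;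
        simp add: xnew_def first_part_def)+
    have [measurable]: "(\<lambda>\<omega>. emp_quantile \<tau> n (\<lambda>i. (1 - h_new n \<omega> i) * u n \<omega> i)) \<in> borel_measurable M"
      "(\<lambda>\<omega>. emp_quantile \<tau> n (\<lambda>i. (1 - g_new n \<omega> i) * v n \<omega> i)) \<in> borel_measurable M"
      if "0 < n" "0 < \<tau>" "\<tau> < 1" for n \<tau>
      using that by (intro borel_measurable_emp_quantile; simp)+
    show "\<forall>\<^sub>F n in sequentially. {\<omega> \<in> space M.
      emp_quantile (1 - \<alpha> / 2) n (\<lambda>i. (1 - h_new n \<omega> i) * u n \<omega> i)
      - emp_quantile (\<alpha> / 2) n (\<lambda>i. (1 - h_new n \<omega> i) * u n \<omega> i)
      < emp_quantile (1 - \<alpha> / 2) n (\<lambda>i. (1 - g_new n \<omega> i) * v n \<omega> i)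
      - emp_quantile (\<alpha> / 2) n (\<lambda>i. (1 - g_new n \<omega> i) * v n \<omega> i)} \<in> events"
      using eventually_gt_at_top[of 0]
    proof eventually_elim
      case (elim n)
      note [measurable] = \<open>0 < n\<close> tau
      show ?case by measurable
    qed
  qed
qed

end
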